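(* Let $A,B$ be finite alphabets with $\mathrm{Card}(A)>\mathrm{Card}(B)\ge 2$, let $\pi:A^{\mathbb N}\to B^{\mathbb N}$ be the amalgamation map induced by a surjection $\pi:A\to B$, and let $\psi:A^{\mathbb N}\to\mathbb R$ be such that $\sum_{s=0}^\infty s^2\,\mathrm{var}_s\psi<\infty$, with associated Gibbs measure $\mu_\psi$. Then the measure $\mu_\psi\circ\pi^{-1}$ is a Gibbs measure with support $B^{\mathbb N}$ for a normalized potential $\phi:B^{\mathbb N}\to\mathbb R$ (i.e. of topological pressure $0$) defined by the limit $$\phi(\boldsymbol b)=\lim_{r\to\infty}\lim_{n\to\infty}\log\left(\frac{\mu_{\psi_r}\circ\pi^{-1}[\boldsymbol b_0^n]}{\mu_{\psi_r}\circ\pi^{-1}[\boldsymbol b_1^n]}\right),\qquad \boldsymbol b\in B^{\mathbb N},$$ where $\psi_r$ is the $(r+1)$-symbol approximant of $\psi$ and $\mu_{\psi_r}$ its Gibbs measure. Moreover: (1) (Subexponential decay) If $\mathrm{var}_n\psi\le C\exp(-c\,n^\gamma)$ for all $n\in\mathbb N$, for some $c,C>0$ and $\gamma\in(0,1)$, then there are constants $D>C$ and $0<d<c$ such that $$\mathrm{var}_n(\phi)\le D\exp\left(-d\,n^{\frac{\gamma}{1+\gamma}}\right)\qquad\text{for all } n\in\mathbb N.$$ (2) (Polynomial decay) If $\mathrm{var}_n\psi\le C\,n^{-q}$ for all $n\ge1$, for some $C>0$ and $q>3$, then for every $\epsilon\in(0,q-3)$ there is a constant $D>C$ such that $$\mathrm{var}_n(\phi)\le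 D\,\frac{1}{n^{q-2-\epsilon}}\qquad\text{for all } n\ge 1.$$
   Context: $\mathbb N=\{0,1,2,\dots\}$. For a finite alphabet $A$, $A^{\mathbb N}$ is the space of infinite sequences with the product topology, and $T:A^{\mathbb N}\to A^{\mathbb N}$, $(T\boldsymbol a)_n=\boldsymbol a_{n+1}$, is the shift (similarly on $B^{\mathbb N}$). $\boldsymbol a_m^n$ denotes the word $\boldsymbol a_m\boldsymbol a_{m+1}\cdots\boldsymbol a_n$. For a word $\boldsymbol w$ of length $m+1$, $[\boldsymbol w]=\{\boldsymbol a:\boldsymbol a_0^m=\boldsymbol w\}$ is the cylinder based on $\boldsymbol w$; $\mu[\boldsymbol w]$ is its measure. Amalgamation map: a surjective map $\pi:A\to B$ is extended to $\pi:A^{\mathbb N}\to B^{\mathbb N}$ by $(\pi\boldsymbol a)_n=\pi(\boldsymbol a_n)$. $\mu\circ\pi^{-1}$ is the pushforward measure. A potential is a function $\psi:A^{\mathbb N}\to\mathbb R$. Its variation is $\mathrm{var}_n\psi=\sup\{|\psi(\boldsymbol a)-\psi(\boldsymbol b)|:\boldsymbol a,\boldsymbol b\in A^{\mathbb N},\ \boldsymbol a_0^n=\boldsymbol b_0^n\}$ (same definition on $B^{\mathbb N}$). Throughout, the potential $\psi$ is assumed to satisfy $\sum_{n\ge0}\mathrm{var}_n\psi<\infty$. Let $S_n\psi=\sum_{k=0}^{n-1}\psi\circ T^k$. A $T$-invariant Borel probability measure $\mu$ is a Gibbs measure for a continuous potential $\psi$ if there are constants $C\ge1$ and $P\in\mathbb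 R$ such that $$C^{-1}\le\frac{\mu[\boldsymbol a_0^n]}{\exp(S_{n+1}\psi(\boldsymbol a)-(n+1)P)}\le C$$ for all $n\in\mathbb N$ and all $\boldsymbol a$. The constant $P$ is the topological pressure $P(\psi)=\limsup_{n\to\infty}\frac1n\log\sum_{\boldsymbol a:\,T^n\boldsymbol a=\boldsymbol a}\exp(S_n\psi(\boldsymbol a))$; $\psi$ is normalized if $P(\psi)=0$. When $\sum_{n\ge0}\mathrm{var}_n\psi<\infty$ there is a unique Gibbs measure for $\psi$, denoted $\mu_\psi$ (known theorem). The $(r+1)$-symbol approximant of a continuous $\psi$ is $\psi_r(\boldsymbol a)=\max\{\psi(\boldsymbol b):\boldsymbol b\in[\boldsymbol a_0^r]\}$; it depends only on $\boldsymbol a_0^r$, and its Gibbs measure $\mu_{\psi_r}$ is an $r$-step Markov measure. *)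

theory Defs
  imports "HOL-Probability.Probability"
begin

text \<open>
  Alphabets are types of sort \<open>{finite, discrete_topology}\<close>; the space of sequences is
  \<open>nat \<Rightarrow> 'a\<close> with the library's product topology, and \<open>borel\<close> is its Borel
  sigma-algebra.
\<close>

definition shift :: "(nat \<Rightarrow> 'a) \<Rightarrow> (nat \<Rightarrow> 'a)" where
  "shift a = (\<lambda>n. a (Suc n))"

text \<open>\<open>word a m n\<close> is \<open>a\<^sub>m \<dots> a\<^sub>n\<close>, both ends included; it is empty if \<open>n < m\<close>.\<close>

definition word :: "(nat \<Rightarrow> 'a) \<Rightarrow> nat \<Rightarrow> nat \<Rightarrow> 'a list" where
  "word a m n = map a [m..<Suc n]"

definition cylinder :: "'a list \<Rightarrow> (nat \<Rightarrow> 'a) set" where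
  "cylinder w = {a. map a [0..<length w] = w}"

text \<open>
  The variation is extended-real valued, so that the supremum is meaningful (namely infinite)
  also for unbounded functions.
\<close>

definition variation :: "((nat \<Rightarrow> 'a) \<Rightarrow> real) \<Rightarrow> nat \<Rightarrow> ennreal" where
  "variation \<psi> n = (SUP (a, b) \<in> {(a, b). word a 0 n = word b 0 n}. ennreal \<bar>\<psi> a - \<psi> b\<bar>)"

definition birkhoff_sum :: "nat \<Rightarrow> ((nat \<Rightarrow> 'a) \<Rightarrow> real) \<Rightarrow> (nat \<Rightarrow> 'a) \<Rightarrow> real" where
  "birkhoff_sum n \<psi> a = (\<Sum>k<n. \<psi> ((shift ^^ k) a))"

text \<open>
  For a finite alphabet and \<open>n \<ge> 1\<close> the sum ranges over a finite set; the value at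
  \<open>n = 0\<close> is irrelevant for the limit superior.
\<close>

definition pressure :: "((nat \<Rightarrow> 'a) \<Rightarrow> real) \<Rightarrow> ereal" where
  "pressure \<psi> =
     limsup (\<lambda>n. ereal (1 / real n *
       ln (\<Sum>a | (shift ^^ n) a = a. exp (birkhoff_sum n \<psi> a))))"

definition gibbs_measure ::
    "(nat \<Rightarrow> 'a :: {finite, discrete_topology}) measure \<Rightarrow> ((nat \<Rightarrow> 'a) \<Rightarrow> real) \<Rightarrow> bool" where
  "gibbs_measure \<mu> \<psi> \<longleftrightarrow>
     continuous_on UNIV \<psi> \<and>
     sets \<mu> = sets borel \<and> prob_space \<mu> \<and> distr \<mu> borel shift = \<mu> \<and>
     (\<exists>C P :: real. C \<ge> 1 \<and> (\<forall>n a.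
        inverse C \<le> measure \<mu> (cylinder (word a 0 n))
                       / exp (birkhoff_sum (n + 1) \<psi> a - real (n + 1) * P) \<and>
        measure \<mu> (cylinder (word a 0 n))
          / exp (birkhoff_sum (n + 1) \<psi> a - real (n + 1) * P) \<le> C))"

text \<open>
  The \<open>(r + 1)\<close>-symbol approximant. For continuous \<open>\<psi>\<close> over a finite alphabet
  the cylinder is compact, so that this supremum is a maximum.
\<close>

definition approximant :: "((nat \<Rightarrow> 'a) \<Rightarrow> real) \<Rightarrow> nat \<Rightarrow> (nat \<Rightarrow> 'a) \<Rightarrow> real" where
  "approximant \<psi> r a = (SUP b \<in> cylinder (word a 0 r). \<psi> b)"

definition amalgamation :: "('a \<Rightarrow> 'b) \<Rightarrow> (nat \<Rightarrow> 'a) \<Rightarrow> (nat \<Rightarrow> 'b)" where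
  "amalgamation p a = (\<lambda>n. p (a n))"

definition pushforward ::
    "('a \<Rightarrow> 'b) \<Rightarrow> (nat \<Rightarrow> 'a :: {finite, discrete_topology}) measure
      \<Rightarrow> (nat \<Rightarrow> 'b :: {finite, discrete_topology}) measure" where
  "pushforward p \<mu> = distr \<mu> borel (amalgamation p)"

definition measure_support :: "'c :: topological_space measure \<Rightarrow> 'c set" where
  "measure_support \<mu> = {x. \<forall>U. open U \<and> x \<in> U \<longrightarrow> emeasure \<mu> U > 0}"

end

theory Submission
  imports Defs "HOL-Real_Asymp.Real_Asymp"
begin

text \<open>
  Write \<open>Z(S\<^sub>1 \<dots> S\<^sub>N)\<close> for the partition function of a potential over the words whose
  letters are constrained to sets \<open>S\<^sub>i\<close>. The quotients
  \<open>Z(A\<^sup>k S\<^sub>0 S\<^sub>1 \<dots> S\<^sub>n) / Z(A\<^sup>k A S\<^sub>1 \<dots> S\<^sub>n)\<close>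
  converge to a limit \<open>q(S\<^sub>0, S\<^sub>1, \<dots>)\<close>, because the quotient of two transfer operators
  has its oscillation contracted by a fixed factor through each block of length \<open>r\<close>, up to an error
  bounded by the tail \<open>\<Sum>\<^bsub>s \<ge> r\<^esub> var\<^sub>s \<psi>\<close>. The bounds only involve the variations, so they hold
  simultaneously for \<open>\<psi>\<close> and all its approximants, and \<open>q\<close> for \<open>\<psi>\<^sub>r\<close> converges to \<open>q\<close> for
  \<open>\<psi>\<close>. By uniqueness of the Gibbs measure the conditional measures of cylinders are
  values of \<open>q\<close>, so \<open>\<phi>(b) = ln q(\<pi>\<^sup>-\<^sup>1 b\<^sub>0, \<pi>\<^sup>-\<^sup>1 b\<^sub>1, \<dots>)\<close>. Products of values of \<open>q\<close> telescope
  to partition functions, which is the Gibbs property of \<open>\<phi>\<close> with pressure 0, and optimizing the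
  number of blocks against their length gives the decay of the variations of \<open>\<phi>\<close>.
\<close>

text \<open>A cylinder of the amalgamated measure prescribes at each position a fibre of
  \<open>p\<close> and leaves the choice of a letter in it. This is why partition functions carry
  sets as constraints: the estimates are uniform over all nonempty sets, and then the amalgamation
  itself costs nothing.

  The obstacle to contraction is that subtracting a multiple \<open>m * \<Psi>\<close> lying below
  \<open>\<Phi>\<close> destroys the distortion bounds that both functions enjoy. Enlarging
  \<open>m\<close> by the factor \<open>exp (2 * tail r)\<close> restores a one-sided bound after a
  block of length \<open>r\<close>. This is the error term of the overview. It does not accumulate
  over the blocks, since it enters with the complementary weight of a convex combination.

  Uniqueness must be proved because the hypotheses only hand over some invariant measure with Gibbs
  bounds. The bounds make it comparable with the weights built from the values of \<open>q\<close>,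
  and the comparison then has to be upgraded to equality.\<close>

section \<open>Transfer operators with constraints\<close>

text \<open>The list of constraints is read leftwards from \<open>v\<close>: its head constrains the letter placed
  immediately before \<open>v\<close>.\<close>

fun transfer :: "((nat \<Rightarrow> 'a) \<Rightarrow> real) \<Rightarrow> 'a set list \<Rightarrow> ((nat \<Rightarrow> 'a) \<Rightarrow> real) \<Rightarrow> (nat \<Rightarrow> 'a) \<Rightarrow> real" where
  "transfer f [] \<Phi> v = \<Phi> v"
| "transfer f (S # Ss) \<Phi> v = (\<Sum>s\<in>S. exp (f (case_nat s v)) * transfer f Ss \<Phi> (case_nat s v))"

lemma transfer_append: "transfer f (Xs @ Ys) \<Phi> v = transfer f Xs (transfer f Ys \<Phi>) v"
  by (induction Xs arbitrary: v) auto

lemma transfer_append': "transfer f (Xs @ Ys) \<Phi> = transfer f Xs (transfer f Ys \<Phi>)"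
  by (rule ext) (rule transfer_append)

lemma transfer_mono: "(\<And>u. \<Phi> u \<le> \<Psi> u) \<Longrightarrow> transfer f Xs \<Phi> v \<le> transfer f Xs \<Psi> v"
  by (induction Xs arbitrary: v) (auto intro!: sum_mono mult_left_mono)

lemma transfer_nonneg: "(\<And>u. 0 \<le> \<Phi> u) \<Longrightarrow> 0 \<le> transfer f Xs \<Phi> v"
  by (induction Xs arbitrary: v) (auto intro!: sum_nonneg)

lemma transfer_pos:
  fixes f :: "(nat \<Rightarrow> 'a::finite) \<Rightarrow> real"
  shows "(\<And>u. 0 < \<Phi> u) \<Longrightarrow> {} \<notin> set Xs \<Longrightarrow> 0 < transfer f Xs \<Phi> v"
  by (induction Xs arbitrary: v) (auto intro!: sum_pos)

lemma transfer_scale: "transfer f Xs (\<lambda>u. c * \<Phi> u) v = c * transfer f Xs \<Phi> v"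
  by (induction Xs arbitrary: v) (auto simp: sum_distrib_left mult_ac)

lemma transfer_diff:
  "transfer f Xs (\<lambda>u. \<Phi> u - \<Psi> u) v = transfer f Xs \<Phi> v - transfer f Xs \<Psi> v"
  by (induction Xs arbitrary: v) (auto simp: right_diff_distrib sum_subtractf)

lemma transfer_split_set:
  fixes f :: "(nat \<Rightarrow> 'a::finite) \<Rightarrow> real"
  shows "transfer f (Xs @ S # Ys) \<Phi> v = (\<Sum>s\<in>S. transfer f (Xs @ {s} # Ys) \<Phi> v)"
proof (induction Xs arbitrary: v)
  case Nil
  then show ?case by simp
next
  case (Cons X Xs)
  then show ?case
    by (simp add: sum_distrib_left) (rule sum.swap)
qed

lemma transfer_tendsto:
  assumes "\<And>u. (\<lambda>r. g r u) \<longlonglongrightarrow> f u"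
  shows "(\<lambda>r. transfer (g r) Xs \<Phi> v) \<longlonglongrightarrow> transfer f Xs \<Phi> v"
  by (induction Xs arbitrary: v) (auto intro!: tendsto_intros assms)

text \<open>A bound on the projective (Hilbert) distance: the supremum of
  \<open>\<Phi> / \<Psi>\<close> is at most \<open>1 + \<rho>\<close> times its infimum. It is
  insensitive to rescaling either function, so the growth of partition functions does not
  enter.\<close>

definition spread :: "real \<Rightarrow> ('x \<Rightarrow> real) \<Rightarrow> ('x \<Rightarrow> real) \<Rightarrow> bool" where
  "spread \<rho> \<Phi> \<Psi> \<longleftrightarrow> (\<forall>u u'. \<Phi> u / \<Psi> u \<le> (1 + \<rho>) * (\<Phi> u' / \<Psi> u'))"

lemma spread_bounds:
  assumes "spread \<rho> \<Phi> \<Psi>" and pos: "\<And>u. 0 < \<Phi> u" "\<And>u. 0 < \<Psi> u" and "\<rho> \<ge> 0"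
  obtains m where "m > 0" "\<And>u. m * \<Psi> u \<le> \<Phi> u" "\<And>u. \<Phi> u \<le> (1 + \<rho>) * m * \<Psi> u"
proof -
  define m where "m = (INF u. \<Phi> u / \<Psi> u)"
  have bdd: "bdd_below (range (\<lambda>u. \<Phi> u / \<Psi> u))"
    by (rule bdd_belowI[of _ 0]) (auto simp: less_imp_le pos)
  have lo: "m \<le> \<Phi> u / \<Psi> u" for u
    unfolding m_def using bdd by (rule cINF_lower) simp
  have up: "\<Phi> u / \<Psi> u / (1 + \<rho>) \<le> m" for u
    unfolding m_def
  proof (rule cINF_greatest)
    show "\<Phi> u / \<Psi> u / (1 + \<rho>) \<le> \<Phi> u' / \<Psi> u'" for u'
      using assms unfolding spread_def by (subst pos_divide_le_eq) (auto simp: mult.commute)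
  qed simp
  show thesis
  proof (rule that)
    have "0 < \<Phi> undefined / \<Psi> undefined / (1 + \<rho>)"
      using pos \<open>\<rho> \<ge> 0\<close> by (intro divide_pos_pos) auto
    also note up
    finally show "m > 0" .
    show "m * \<Psi> u \<le> \<Phi> u" for u
      using lo[of u] pos(2)[of u] by (simp add: le_divide_eq)
    show "\<Phi> u \<le> (1 + \<rho>) * m * \<Psi> u" for u
      using up[of u] pos(2)[of u] \<open>\<rho> \<ge> 0\<close> by (simp add: divide_le_eq mult_ac)
  qed
qed

lemma spread_sym:
  assumes "spread \<rho> \<Phi> \<Psi>" and pos: "\<And>u. 0 < \<Phi> u" "\<And>u. 0 < \<Psi> u"
  shows "spread \<rho> \<Psi> \<Phi>"
  unfolding spread_def
proof (intro allI)
  fix u u'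
  have "\<Phi> u' / \<Psi> u' \<le> (1 + \<rho>) * (\<Phi> u / \<Psi> u)" using assms(1) by (auto simp: spread_def)
  then show "\<Psi> u / \<Phi> u \<le> (1 + \<rho>) * (\<Psi> u' / \<Phi> u')"
    using pos[of u] pos[of u'] by (simp add: field_simps)
qed

text \<open>The quotient of two transfers is an average of the original quotient.\<close>

lemma spread_transfer:
  fixes f :: "(nat \<Rightarrow> 'a::finite) \<Rightarrow> real"
  assumes "spread \<rho> \<Phi> \<Psi>" and pos: "\<And>u. 0 < \<Phi> u" "\<And>u. 0 < \<Psi> u" and "\<rho> \<ge> 0"
    and "{} \<notin> set Xs" "{} \<notin> set Ys"
  shows "transfer f Xs \<Phi> v / transfer f Xs \<Psi> v \<le> (1 + \<rho>) * (transfer f Ys \<Phi> v' / transfer f Ys \<Psi> v')"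
proof -
  obtain m where m: "m > 0" "\<And>u. m * \<Psi> u \<le> \<Phi> u" "\<And>u. \<Phi> u \<le> (1 + \<rho>) * m * \<Psi> u"
    using spread_bounds assms by blast
  have "transfer f Xs \<Phi> v \<le> (1 + \<rho>) * m * transfer f Xs \<Psi> v"
    unfolding transfer_scale[symmetric] by (rule transfer_mono) (rule m)
  moreover have "0 < transfer f Xs \<Psi> v" using assms by (intro transfer_pos) auto
  ultimately have 1: "transfer f Xs \<Phi> v / transfer f Xs \<Psi> v \<le> (1 + \<rho>) * m"
    by (simp add: divide_le_eq)
  have "m * transfer f Ys \<Psi> v' \<le> transfer f Ys \<Phi> v'"
    unfolding transfer_scale[symmetric] by (rule transfer_mono) (rule m)
  moreover have "0 < transfer f Ys \<Psi> v'" using assms by (intro transfer_pos) auto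
  ultimately have 2: "m \<le> transfer f Ys \<Phi> v' / transfer f Ys \<Psi> v'"
    by (simp add: le_divide_eq)
  show ?thesis using 1 mult_left_mono[OF 2, of "1 + \<rho>"] \<open>\<rho> \<ge> 0\<close> by linarith
qed

text \<open>\<open>w\<close> is any summable majorant of the variations instead of the variations
  themselves, so that a potential and all its approximants are instances with the same
  \<open>w\<close>, hence with the same constants.\<close>

locale summable_potential =
  fixes f :: "(nat \<Rightarrow> 'a::finite) \<Rightarrow> real" and w :: "nat \<Rightarrow> real"
  assumes var_le: "(\<And>i. i \<le> n \<Longrightarrow> a i = b i) \<Longrightarrow> \<bar>f a - f b\<bar> \<le> w n"
    and summable_w: "summable w"
begin

lemma w_nonneg: "0 \<le> w n"
  using var_le[of n "\<lambda>_. undefined" "\<lambda>_. undefined"] by simp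

definition tail :: "nat \<Rightarrow> real" where
  "tail j = (\<Sum>i. w (i + j))"

lemma tail_Suc: "tail j = w j + tail (Suc j)"
  unfolding tail_def
  using suminf_split_head[of "\<lambda>i. w (i + j)"] summable_w by (simp add: summable_iff_shift)

lemma tail_nonneg: "0 \<le> tail j"
  unfolding tail_def by (rule suminf_nonneg) (simp_all add: summable_iff_shift summable_w w_nonneg)

lemma tail_le_0: "tail j \<le> tail 0"
proof (induction j)
  case (Suc j)
  then show ?case using tail_Suc[of j] w_nonneg[of j] by linarith
qed simp

lemma tail_tendsto: "tail \<longlonglongrightarrow> 0"
  using suminf_exist_split2[OF summable_w] by (simp add: tail_def[abs_def])

text \<open>Each letter placed in front of two points that agree on \<open>j\<close> coordinates
  makes them agree on one more, so the successive differences of \<open>f\<close> are at most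
  \<open>w j\<close>, \<open>w (j + 1)\<close>, and so on. Their sum is the part of
  \<open>tail j\<close> not yet contained in \<open>tail (j + length Xs)\<close>. The functions on
  the two sides may differ because the contraction step compares unequal ones.\<close>

lemma transfer_distortion:
  assumes "\<And>u. 0 \<le> \<Phi> u"
    and "\<And>u u'. (\<And>i. i < j + length Xs \<Longrightarrow> u i = u' i) \<Longrightarrow> \<Psi> u' \<le> exp (tail (j + length Xs)) * \<Phi> u"
    and "\<And>i. i < j \<Longrightarrow> v i = v' i"
  shows "transfer f Xs \<Psi> v' \<le> exp (tail j) * transfer f Xs \<Phi> v"
  using assms
proof (induction Xs arbitrary: j v v')
  case Nil
  then show ?case by simp
next
  case (Cons S Xs)
  have "exp (f (case_nat s v')) * transfer f Xs \<Psi> (case_nat s v')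
      \<le> exp (tail j) * (exp (f (case_nat s v)) * transfer f Xs \<Phi> (case_nat s v))" for s
  proof -
    have agree: "(case_nat s v :: nat \<Rightarrow> 'a) i = case_nat s v' i" if "i < Suc j" for i
      using that Cons.prems(3) by (cases i) auto
    have IH: "transfer f Xs \<Psi> (case_nat s v') \<le> exp (tail (Suc j)) * transfer f Xs \<Phi> (case_nat s v)"
    proof (rule Cons.IH)
      show "\<Psi> u' \<le> exp (tail (Suc j + length Xs)) * \<Phi> u"
        if "\<And>i. i < Suc j + length Xs \<Longrightarrow> u i = u' i" for u u'
        using Cons.prems(2)[of u u'] that by simp
    qed (use Cons.prems agree in auto)
    have "f (case_nat s v') \<le> w j + f (case_nat s v)"
      using var_le[of j "case_nat s v" "case_nat s v'"] agree by fastforce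
    then have "exp (f (case_nat s v')) \<le> exp (w j) * exp (f (case_nat s v))"
      by (simp add: exp_add[symmetric])
    then have "exp (f (case_nat s v')) * (exp (tail (Suc j)) * transfer f Xs \<Phi> (case_nat s v))
      \<le> (exp (w j) * exp (f (case_nat s v))) * (exp (tail (Suc j)) * transfer f Xs \<Phi> (case_nat s v))"
      by (intro mult_right_mono mult_nonneg_nonneg transfer_nonneg Cons.prems) auto
    moreover have "exp (f (case_nat s v')) * transfer f Xs \<Psi> (case_nat s v')
      \<le> exp (f (case_nat s v')) * (exp (tail (Suc j)) * transfer f Xs \<Phi> (case_nat s v))"
      using IH by (intro mult_left_mono) auto
    ultimately show ?thesis
      unfolding tail_Suc[of j] exp_add by (simp only: mult_ac)
  qed
  then show ?case
    by (simp add: sum_distrib_left sum_mono)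
qed

text \<open>A cone of functions with exactly the distortion that \<open>transfer\<close> reproduces:
  it contains the constants and is invariant, with no loss in the bound.\<close>

definition reg :: "((nat \<Rightarrow> 'a) \<Rightarrow> real) \<Rightarrow> bool" where
  "reg \<Phi> \<longleftrightarrow> (\<forall>u. 0 < \<Phi> u) \<and>
    (\<forall>j u u'. (\<forall>i<j. u i = u' i) \<longrightarrow> \<Phi> u' \<le> exp (tail j) * \<Phi> u)"

lemma reg_pos: "reg \<Phi> \<Longrightarrow> 0 < \<Phi> u"
  by (simp add: reg_def)

lemma reg_le: "reg \<Phi> \<Longrightarrow> (\<And>i. i < j \<Longrightarrow> u i = u' i) \<Longrightarrow> \<Phi> u' \<le> exp (tail j) * \<Phi> u"
  by (simp add: reg_def)

lemma reg_one: "reg (\<lambda>_. 1)"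
  by (simp add: reg_def tail_nonneg)

lemma reg_transfer: "reg \<Phi> \<Longrightarrow> {} \<notin> set Xs \<Longrightarrow> reg (transfer f Xs \<Phi>)"
  unfolding reg_def[of "transfer f Xs \<Phi>"]
proof (intro conjI allI impI)
  assume "reg \<Phi>" "{} \<notin> set Xs"
  then show "0 < transfer f Xs \<Phi> u" for u by (intro transfer_pos reg_pos)
  show "transfer f Xs \<Phi> u' \<le> exp (tail j) * transfer f Xs \<Phi> u" if "\<forall>i<j. u i = u' i" for j u u'
    using \<open>reg \<Phi>\<close> that
    by (intro transfer_distortion) (auto intro: less_imp_le reg_pos reg_le)
qed

lemma spread_reg:
  assumes "reg \<Phi>" "reg \<Psi>"
  shows "spread (exp (2 * tail 0) - 1) \<Phi> \<Psi>"
  unfolding spread_def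
proof (intro allI)
  fix u u'
  have "\<Phi> u \<le> exp (tail 0) * \<Phi> u'" "\<Psi> u' \<le> exp (tail 0) * \<Psi> u"
    using assms by (auto intro!: reg_le)
  then have "\<Phi> u * \<Psi> u' \<le> (exp (tail 0) * \<Phi> u') * (exp (tail 0) * \<Psi> u)"
    using reg_pos[OF assms(1)] reg_pos[OF assms(2)]
    by (intro mult_mono) (auto intro: less_imp_le mult_nonneg_nonneg)
  also have "\<dots> = exp (2 * tail 0) * (\<Phi> u' * \<Psi> u)"
    by (simp add: mult_exp_exp mult_ac flip: mult.assoc)
  finally show "\<Phi> u / \<Psi> u \<le> (1 + (exp (2 * tail 0) - 1)) * (\<Phi> u' / \<Psi> u')"
    using reg_pos[OF assms(2), of u] reg_pos[OF assms(2), of u'] by (simp add: field_simps)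
qed

text \<open>If \<open>m\<close> bounds \<open>\<Phi> / \<Psi>\<close> from below, the remainder
  \<open>\<Phi> - m * \<Psi>\<close> is nonnegative, and after the block its transfers at any two
  points are comparable up to the error. Hence an excess of the new quotient over \<open>m\<close>
  at one point forces a fixed fraction \<open>\<kappa>\<close> of it at every other point.\<close>

lemma spread_contract:
  assumes "reg \<Phi>" "reg \<Psi>" "spread \<rho> \<Phi> \<Psi>" "\<rho> \<ge> 0" and ne: "{} \<notin> set Xs"
  defines "\<kappa> \<equiv> exp (- 2 * tail 0)"
  shows "spread ((1 - \<kappa>) * \<rho> + \<kappa> * (exp (2 * tail (length Xs)) - 1)) (transfer f Xs \<Phi>) (transfer f Xs \<Psi>)"
  unfolding spread_def
proof (intro allI)
  fix v' v
  let ?n = "length Xs" and ?P = "transfer f Xs \<Phi>" and ?Q = "transfer f Xs \<Psi>"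
  note pos = reg_pos[OF \<open>reg \<Phi>\<close>] reg_pos[OF \<open>reg \<Psi>\<close>]
  obtain m where m: "m > 0" "\<And>u. m * \<Psi> u \<le> \<Phi> u" "\<And>u. \<Phi> u \<le> (1 + \<rho>) * m * \<Psi> u"
    using spread_bounds assms pos by blast
  \<comment> \<open>The remainder alone has no distortion bound, as \<open>\<Phi>\<close> and
    \<open>\<Psi>\<close> may vary in opposite directions. Replacing \<open>m\<close> by
    \<open>m * exp (2 * tail ?n)\<close> at \<open>v'\<close> pays for the variation of
    \<open>\<Psi>\<close> and for the factor in front of \<open>\<Phi>\<close>.\<close>
  have "transfer f Xs (\<lambda>u. \<Phi> u - (m * exp (2 * tail ?n)) * \<Psi> u) v'
      \<le> exp (tail 0) * transfer f Xs (\<lambda>u. \<Phi> u - m * \<Psi> u) v"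
  proof (rule transfer_distortion)
    fix u u' :: "nat \<Rightarrow> 'a" assume "\<And>i. i < 0 + ?n \<Longrightarrow> u i = u' i"
    then have "\<Phi> u' \<le> exp (tail ?n) * \<Phi> u" "\<Psi> u \<le> exp (tail ?n) * \<Psi> u'"
      using assms(1,2) by (auto intro!: reg_le)
    moreover from this(2) have "exp (tail ?n) * m * \<Psi> u \<le> exp (tail ?n) * m * (exp (tail ?n) * \<Psi> u')"
      using m(1) by (intro mult_left_mono) auto
    moreover have "exp (tail ?n) * m * (exp (tail ?n) * \<Psi> u') = m * exp (2 * tail ?n) * \<Psi> u'"
      by (simp add: exp_double power2_eq_square)
    ultimately show "\<Phi> u' - (m * exp (2 * tail ?n)) * \<Psi> u' \<le> exp (tail (0 + ?n)) * (\<Phi> u - m * \<Psi> u)"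
      unfolding add_0 right_diff_distrib mult.assoc[symmetric] by linarith
  qed (use m in auto)
  then have 1: "?P v' - m * exp (2 * tail ?n) * ?Q v' \<le> exp (tail 0) * (?P v - m * ?Q v)"
    by (simp add: transfer_diff transfer_scale)
  have Q: "0 < ?Q v" "0 < ?Q v'" using pos ne by (auto intro!: transfer_pos)
  define x where "x = ?P v / ?Q v"
  define y where "y = ?P v' / ?Q v'"
  have P: "?P v = x * ?Q v" "?P v' = y * ?Q v'" using Q by (auto simp: x_def y_def)
  have "m * ?Q v \<le> ?P v" unfolding transfer_scale[symmetric] by (rule transfer_mono) (rule m)
  then have mx: "m \<le> x" using Q P by simp
  have "?P v' \<le> (1 + \<rho>) * m * ?Q v'" unfolding transfer_scale[symmetric] by (rule transfer_mono) (rule m)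
  then have ym: "y \<le> (1 + \<rho>) * m" using Q P by simp
  have "reg ?Q" using assms by (intro reg_transfer)
  then have "?Q v \<le> exp (tail 0) * ?Q v'" by (auto intro!: reg_le)
  then have "exp (tail 0) * ((x - m) * ?Q v) \<le> exp (tail 0) * ((x - m) * (exp (tail 0) * ?Q v'))"
    using mx by (intro mult_left_mono) auto
  then have "(y - m * exp (2 * tail ?n)) * ?Q v' \<le> (exp (2 * tail 0) * (x - m)) * ?Q v'"
    using 1 unfolding P by (simp add: algebra_simps exp_double power2_eq_square)
  then have "y - m * exp (2 * tail ?n) \<le> exp (2 * tail 0) * (x - m)"
    using Q by simp
  then have "\<kappa> * (y - m * exp (2 * tail ?n)) \<le> \<kappa> * (exp (2 * tail 0) * (x - m))"
    by (intro mult_left_mono) (auto simp: \<kappa>_def)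
  also have "\<dots> = x - m" by (simp add: \<kappa>_def mult_exp_exp flip: mult.assoc)
  \<comment> \<open>\<open>y - x\<close> is \<open>(y - m) - (x - m)\<close>, and
    \<open>x - m\<close> dominates the fraction \<open>\<kappa>\<close> of
    \<open>y - m * exp (2 * tail ?n)\<close>.\<close>
  finally have "y - x \<le> (1 - \<kappa>) * (y - m) + \<kappa> * m * (exp (2 * tail ?n) - 1)"
    by (simp add: algebra_simps)
  also have "(1 - \<kappa>) * (y - m) \<le> (1 - \<kappa>) * (\<rho> * m)"
    using ym tail_nonneg[of 0] by (intro mult_left_mono) (auto simp: \<kappa>_def algebra_simps)
  also have "(1 - \<kappa>) * (\<rho> * m) + \<kappa> * m * (exp (2 * tail ?n) - 1)
     = ((1 - \<kappa>) * \<rho> + \<kappa> * (exp (2 * tail ?n) - 1)) * m" by (simp add: algebra_simps)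
  also have "\<dots> \<le> ((1 - \<kappa>) * \<rho> + \<kappa> * (exp (2 * tail ?n) - 1)) * x"
    using mx \<open>\<rho> \<ge> 0\<close> tail_nonneg
    by (intro mult_left_mono add_nonneg_nonneg mult_nonneg_nonneg) (auto simp: \<kappa>_def)
  finally show "?P v' / ?Q v' \<le> (1 + ((1 - \<kappa>) * \<rho> + \<kappa> * (exp (2 * tail ?n) - 1))) * (?P v / ?Q v)"
    unfolding x_def[symmetric] y_def[symmetric] by (simp add: algebra_simps)
qed

text \<open>The \<open>m\<close>-th iterate of the affine map in \<open>spread_contract\<close> for
  blocks of length \<open>r\<close>. The fixed point is \<open>exp (2 * tail r) - 1\<close>; the
  start value exceeds it by the a priori spread from \<open>spread_reg\<close>.\<close>

definition rate :: "nat \<Rightarrow> nat \<Rightarrow> real" where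
  "rate m r = (1 - exp (- 2 * tail 0)) ^ m * (exp (2 * tail 0) - 1) + (exp (2 * tail r) - 1)"

lemma rate_nonneg: "0 \<le> rate m r"
  unfolding rate_def using tail_nonneg by (intro add_nonneg_nonneg mult_nonneg_nonneg) auto

lemma spread_mono: "spread \<rho> \<Phi> \<Psi> \<Longrightarrow> \<rho> \<le> \<rho>' \<Longrightarrow> (\<And>u. 0 < \<Phi> u) \<Longrightarrow> (\<And>u. 0 < \<Psi> u) \<Longrightarrow> spread \<rho>' \<Phi> \<Psi>"
  unfolding spread_def
proof (intro allI)
  fix u u' assume *: "\<forall>u u'. \<Phi> u / \<Psi> u \<le> (1 + \<rho>) * (\<Phi> u' / \<Psi> u')" "\<rho> \<le> \<rho>'"
    "\<And>u. 0 < \<Phi> u" "\<And>u. 0 < \<Psi> u"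
  have "(1 + \<rho>) * (\<Phi> u' / \<Psi> u') \<le> (1 + \<rho>') * (\<Phi> u' / \<Psi> u')"
    using * by (intro mult_right_mono) (auto simp: less_imp_le)
  then show "\<Phi> u / \<Psi> u \<le> (1 + \<rho>') * (\<Phi> u' / \<Psi> u')" using * order_trans by blast
qed

lemma spread_rate:
  assumes "reg \<Phi>" "reg \<Psi>"
  shows "{} \<notin> set Xs \<Longrightarrow> m * r \<le> length Xs \<Longrightarrow> spread (rate m r) (transfer f Xs \<Phi>) (transfer f Xs \<Psi>)"
proof (induction m arbitrary: Xs)
  case 0
  then have "reg (transfer f Xs \<Phi>)" "reg (transfer f Xs \<Psi>)" using assms by (auto intro: reg_transfer)
  moreover have "exp (2 * tail 0) - 1 \<le> rate 0 r" by (simp add: rate_def tail_nonneg)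
  ultimately show ?case using spread_reg spread_mono reg_pos by blast
next
  case (Suc m)
  \<comment> \<open>Only the block nearest to the evaluation point is peeled off. Surplus letters
    remain in \<open>Zs\<close>, and the base case admits any length.\<close>
  define Ys Zs where "Ys = take r Xs" and "Zs = drop r Xs"
  have Xs: "Xs = Ys @ Zs" and len: "length Ys = r" "m * r \<le> length Zs"
    using Suc.prems by (auto simp: Ys_def Zs_def)
  have ne: "{} \<notin> set Ys" "{} \<notin> set Zs" using Suc.prems Xs by auto
  have "spread (rate m r) (transfer f Zs \<Phi>) (transfer f Zs \<Psi>)"
    using Suc.IH ne len by blast
  from spread_contract[OF _ _ this rate_nonneg ne(1)] assms ne
  have "spread ((1 - exp (- 2 * tail 0)) * rate m r + exp (- 2 * tail 0) * (exp (2 * tail r) - 1))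
    (transfer f Xs \<Phi>) (transfer f Xs \<Psi>)"
    by (simp add: reg_transfer len Xs transfer_append')
  moreover have "(1 - exp (- 2 * tail 0)) * rate m r + exp (- 2 * tail 0) * (exp (2 * tail r) - 1)
     = rate (Suc m) r" by (simp add: rate_def algebra_simps)
  ultimately show ?case by simp
qed

end

section \<open>Memory loss\<close>

text \<open>Reversed because \<open>transfer\<close> consumes the rightmost constraint
  first.\<close>

definition seg :: "(nat \<Rightarrow> 'x) \<Rightarrow> nat \<Rightarrow> nat \<Rightarrow> 'x list" where
  "seg S i j = rev (map S [i..<j])"

lemma seg_split: "i \<le> j \<Longrightarrow> j \<le> n \<Longrightarrow> seg S i n = seg S j n @ seg S i j"
  using upt_add_eq_append[of i j "n - j"] by (simp add: seg_def)

lemma seg_Suc_left: "i < n \<Longrightarrow> seg S i n = seg S (Suc i) n @ [S i]"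
  by (simp add: seg_def upt_conv_Cons)

lemma seg_cong: "(\<And>k. i \<le> k \<Longrightarrow> k < j \<Longrightarrow> S k = S' k) \<Longrightarrow> seg S i j = seg S' i j"
  by (simp add: seg_def)

lemma length_seg [simp]: "length (seg S i j) = j - i"
  by (simp add: seg_def)

lemma empty_notin_seg: "(\<And>i. S i \<noteq> {}) \<Longrightarrow> {} \<notin> set (seg S i j)"
  by (auto simp: seg_def)

lemma seg_shift: "seg (\<lambda>i. S (i + n)) i j = seg S (i + n) (j + n)"
proof -
  have "map (\<lambda>k. S (k + n)) [i..<j] = map S [i + n..<j + n]"
    by (rule nth_equalityI) (auto simp: algebra_simps)
  then show ?thesis by (simp add: seg_def)
qed

lemma tendsto_of_ratio_bounds:
  fixes x :: "'x \<Rightarrow> real"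
  assumes "L > 0" and "\<And>\<eta>. \<eta> > 0 \<Longrightarrow> eventually (\<lambda>t. x t \<le> (1 + \<eta>) * L \<and> L \<le> (1 + \<eta>) * x t) F"
  shows "(x \<longlongrightarrow> L) F"
proof (rule order_tendstoI)
  fix a assume "a > L"
  define \<eta> where "\<eta> = (a - L) / (2 * L)"
  have "\<eta> > 0" "(1 + \<eta>) * L < a"
    using \<open>a > L\<close> \<open>L > 0\<close> by (auto simp: \<eta>_def field_simps)
  then show "eventually (\<lambda>t. x t < a) F"
    using assms(2)[of \<eta>] by (auto elim: eventually_mono)
next
  fix a assume "a < L"
  define a' where "a' = max a (L / 2)"
  define \<eta> where "\<eta> = (L - a') / (2 * L)"
  have a': "a' < L" "0 < a'" using \<open>a < L\<close> \<open>L > 0\<close> by (auto simp: a'_def)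
  then have "\<eta> > 0" using \<open>L > 0\<close> by (auto simp: \<eta>_def)
  have "(1 + \<eta>) * a' \<le> a' + \<eta> * L"
    using a' \<open>\<eta> > 0\<close> by (simp add: algebra_simps)
  also have "\<dots> < L" using a' \<open>L > 0\<close> by (simp add: \<eta>_def field_simps)
  finally have *: "(1 + \<eta>) * a' < L" .
  show "eventually (\<lambda>t. a < x t) F"
    using assms(2)[OF \<open>\<eta> > 0\<close>]
  proof eventually_elim
    case (elim t)
    then have "(1 + \<eta>) * a' < (1 + \<eta>) * x t" using * by linarith
    then have "a' < x t" using \<open>\<eta> > 0\<close> by simp
    then show ?case by (simp add: a'_def)
  qed
qed

section \<open>Conditional weights and their limits\<close>

context summable_potential
begin

abbreviation one_transfer :: "'a set list \<Rightarrow> (nat \<Rightarrow> 'a) \<Rightarrow> real" ("\<T>") where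
  "\<T> Xs \<equiv> transfer f Xs (\<lambda>_. 1)"

lemma rate_small:
  assumes "\<eta> > 0"
  obtains m r where "(1 + rate m r)\<^sup>2 \<le> 1 + \<eta>"
proof -
  \<comment> \<open>The bound 1 on \<open>rate m r\<close> turns the square into
    \<open>1 + 3 * rate m r\<close>, whence the division by 3. The block length is fixed first, the
    number of blocks afterwards.\<close>
  define e where "e = min 1 (\<eta> / 3)"
  have "e > 0" using assms by (simp add: e_def)
  have "(\<lambda>r. exp (2 * tail r) - 1) \<longlonglongrightarrow> exp (2 * 0) - 1"
    by (intro tendsto_intros tail_tendsto)
  then have "eventually (\<lambda>r. exp (2 * tail r) - 1 < e / 2) sequentially"
    by (rule order_tendstoD) (use \<open>e > 0\<close> in auto)
  then obtain r where r: "exp (2 * tail r) - 1 < e / 2"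
    by (auto simp: eventually_sequentially)
  have "(\<lambda>m. (1 - exp (- 2 * tail 0)) ^ m * (exp (2 * tail 0) - 1)) \<longlonglongrightarrow> 0 * (exp (2 * tail 0) - 1)"
    using tail_nonneg[of 0] by (intro tendsto_intros LIMSEQ_power_zero) auto
  then have "eventually (\<lambda>m. (1 - exp (- 2 * tail 0)) ^ m * (exp (2 * tail 0) - 1) < e / 2) sequentially"
    by (rule order_tendstoD) (use \<open>e > 0\<close> in auto)
  then obtain m where m: "(1 - exp (- 2 * tail 0)) ^ m * (exp (2 * tail 0) - 1) < e / 2"
    by (auto simp: eventually_sequentially)
  have \<rho>: "rate m r < e" using m r by (simp add: rate_def)
  have "(rate m r)\<^sup>2 \<le> rate m r * 1"
    unfolding power2_eq_square using \<rho> rate_nonneg by (intro mult_left_mono) (auto simp: e_def)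
  then have "(1 + rate m r)\<^sup>2 \<le> 1 + 3 * rate m r" by (simp add: power2_sum)
  also have "\<dots> \<le> 1 + \<eta>" using \<rho> by (simp add: e_def)
  finally show ?thesis using that by blast
qed

lemma \<T>_pos: "{} \<notin> set Xs \<Longrightarrow> 0 < \<T> Xs v"
  by (rule transfer_pos) auto

text \<open>Cutting a list of constraints costs at most \<open>exp (tail 0)\<close>, the distortion
  of the left piece between points with no common coordinate.\<close>

lemma \<T>_append_le:
  assumes "{} \<notin> set Ys"
  shows "\<T> (Xs @ Ys) v \<le> exp (tail 0) * \<T> Xs v * \<T> Ys v'"
proof -
  have "\<T> Ys u \<le> (exp (tail 0) * \<T> Ys v') * 1" for u
    using reg_le[OF reg_transfer[OF reg_one assms], of 0] by simp
  then have "\<T> (Xs @ Ys) v \<le> transfer f Xs (\<lambda>u. (exp (tail 0) * \<T> Ys v') * 1) v"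
    unfolding transfer_append by (rule transfer_mono)
  then show ?thesis unfolding transfer_scale[of _ _ "exp (tail 0) * \<T> Ys v'" "\<lambda>_. 1"] by (simp only: mult_ac)
qed

lemma \<T>_append_ge:
  assumes "{} \<notin> set Ys"
  shows "\<T> Xs v * \<T> Ys v' \<le> exp (tail 0) * \<T> (Xs @ Ys) v"
proof -
  have "\<T> Ys v' * 1 \<le> exp (tail 0) * \<T> Ys u" for u
    using reg_le[OF reg_transfer[OF reg_one assms], of 0] by simp
  then have "transfer f Xs (\<lambda>u. \<T> Ys v' * 1) v \<le> transfer f Xs (\<lambda>u. exp (tail 0) * \<T> Ys u) v"
    by (rule transfer_mono)
  then show ?thesis
    unfolding transfer_scale[of _ _ "\<T> Ys v'" "\<lambda>_. 1"] transfer_scale[of _ _ "exp (tail 0)" "\<T> Ys"]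
    by (simp only: transfer_append mult_ac)
qed

text \<open>The conditional weight of the symbols in \<open>S\<close> given the constraints \<open>Xs\<close> to their right,
  with \<open>k\<close> unconstrained symbols to their left.\<close>

definition Q :: "nat \<Rightarrow> 'a set \<Rightarrow> 'a set list \<Rightarrow> (nat \<Rightarrow> 'a) \<Rightarrow> real" where
  "Q k S Xs v = \<T> (Xs @ S # replicate k UNIV) v / \<T> (Xs @ replicate (Suc k) UNIV) v"

lemma Q_pos: "{} \<notin> set Xs \<Longrightarrow> S \<noteq> {} \<Longrightarrow> 0 < Q k S Xs v"
  unfolding Q_def by (intro divide_pos_pos \<T>_pos) auto

text \<open>\<open>Ys\<close> is adjacent to \<open>S\<close> and carries \<open>m\<close> blocks,
  so the quotient has small spread after passing through it. The remoter constraints and the base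
  point merely average that quotient.\<close>

lemma Q_right:
  assumes "m * r \<le> length Ys" "{} \<notin> set (Xs @ Ys @ Zs)" "S \<noteq> {}"
  shows "Q k S (Xs @ Ys) v \<le> (1 + rate m r) * Q k S (Zs @ Ys) v'"
proof -
  have r: "reg (\<T> (S # replicate k UNIV))" "reg (\<T> (replicate (Suc k) UNIV))"
    using assms by (intro reg_transfer reg_one; auto)+
  have *: "spread (rate m r) (transfer f Ys (\<T> (S # replicate k UNIV)))
      (transfer f Ys (\<T> (replicate (Suc k) UNIV)))"
    using assms r by (intro spread_rate) auto
  show ?thesis
    unfolding Q_def append_assoc transfer_append'
    by (rule spread_transfer[OF *])
      (use assms r in \<open>simp_all add: transfer_pos rate_nonneg reg_pos del: transfer.simps\<close>)
qed

lemma spread_left: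
  assumes "m * r \<le> k" "m * r \<le> k'"
  shows "spread (rate m r) (\<T> (replicate k UNIV)) (\<T> (replicate k' UNIV))"
proof -
  have *: "spread (rate m r) (\<T> (replicate k UNIV)) (\<T> (replicate k' UNIV))" if "m * r \<le> k" "k \<le> k'" for k k'
  proof -
    have "replicate k' UNIV = replicate k UNIV @ replicate (k' - k) (UNIV :: 'a set)"
      using that by (simp flip: replicate_add)
    then show ?thesis
      unfolding transfer_append'
      using that by (simp only: transfer_append') (intro spread_rate reg_one reg_transfer; simp)
  qed
  show ?thesis
  proof (cases "k \<le> k'")
    case True
    then show ?thesis using * assms by blast
  next
    case False
    then show ?thesis using assms by (intro spread_sym[OF *]) (auto intro!: \<T>_pos)
  qed
qed

text \<open>Cross multiplication exchanges the roles: \<open>Q k S Xs v / Q k' S Xs v\<close>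
  compares the averages of one quotient, that of the free partition functions of lengths
  \<open>k\<close> and \<open>k'\<close>, under the constraints \<open>S\<close> and
  \<open>UNIV\<close>.\<close>

lemma Q_left:
  assumes "m * r \<le> k" "m * r \<le> k'" "{} \<notin> set Xs" "S \<noteq> {}"
  shows "Q k S Xs v \<le> (1 + rate m r) * Q k' S Xs v"
proof -
  have "\<T> ((Xs @ [S]) @ replicate k UNIV) v / \<T> ((Xs @ [S]) @ replicate k' UNIV) v \<le>
    (1 + rate m r) * (\<T> ((Xs @ [UNIV]) @ replicate k UNIV) v / \<T> ((Xs @ [UNIV]) @ replicate k' UNIV) v)"
    unfolding transfer_append'[of f _ "replicate _ _"]
    by (rule spread_transfer[OF spread_left]) (use assms in \<open>auto intro!: \<T>_pos rate_nonneg\<close>)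
  moreover have "0 < \<T> (Xs @ S # replicate k' UNIV) v" "0 < \<T> (Xs @ UNIV # replicate k UNIV) v"
     "0 < \<T> (Xs @ UNIV # replicate k' UNIV) v"
    using assms by (auto intro!: \<T>_pos)
  ultimately show ?thesis
    unfolding Q_def by (simp add: field_simps del: transfer.simps)
qed

lemma Q_compare:
  assumes "m * r \<le> length Ys" "{} \<notin> set (Xs @ Ys @ Zs)" "S \<noteq> {}" "m * r \<le> k" "m * r \<le> k'"
  shows "Q k S (Xs @ Ys) v \<le> (1 + rate m r)\<^sup>2 * Q k' S (Zs @ Ys) v'"
proof -
  have "Q k S (Xs @ Ys) v \<le> (1 + rate m r) * Q k S (Zs @ Ys) v'"
    using assms by (intro Q_right) auto
  also have "Q k S (Zs @ Ys) v' \<le> (1 + rate m r) * Q k' S (Zs @ Ys) v'"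
    using assms by (intro Q_left) auto
  finally show ?thesis
    using rate_nonneg[of m r] by (simp add: power2_eq_square mult_left_mono mult.assoc)
qed

text \<open>Both margins grow along one index to get an ordinary sequence; \<open>Q_tendsto\<close>
  decouples them afterwards.\<close>

definition qseq :: "(nat \<Rightarrow> 'a set) \<Rightarrow> nat \<Rightarrow> real" where
  "qseq S n = Q n (S 0) (seg S 1 (Suc n)) (\<lambda>_. undefined)"

definition qinf :: "(nat \<Rightarrow> 'a set) \<Rightarrow> real" where
  "qinf S = lim (qseq S)"

lemma Q_compare_seg:
  assumes ne: "\<And>i. S i \<noteq> {}" and "{} \<notin> set Xs"
    and "m * r \<le> n" "m * r \<le> n'" "m * r \<le> k" "m * r \<le> k'"
  shows "Q k (S 0) (Xs @ seg S 1 (Suc n)) v \<le> (1 + rate m r)\<^sup>2 * Q k' (S 0) (seg S 1 (Suc n')) v'"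
    and "Q k' (S 0) (seg S 1 (Suc n')) v' \<le> (1 + rate m r)\<^sup>2 * Q k (S 0) (Xs @ seg S 1 (Suc n)) v"
proof -
  have *: "seg S 1 (Suc j) = seg S (Suc (m * r)) (Suc j) @ seg S 1 (Suc (m * r))"
    if "m * r \<le> j" for j using that by (intro seg_split) auto
  show "Q k (S 0) (Xs @ seg S 1 (Suc n)) v \<le> (1 + rate m r)\<^sup>2 * Q k' (S 0) (seg S 1 (Suc n')) v'"
    unfolding *[OF assms(3)] *[OF assms(4)] append_assoc[symmetric]
    by (rule Q_compare) (use assms empty_notin_seg[OF ne] in auto)
  show "Q k' (S 0) (seg S 1 (Suc n')) v' \<le> (1 + rate m r)\<^sup>2 * Q k (S 0) (Xs @ seg S 1 (Suc n)) v"
    unfolding *[OF assms(3)] *[OF assms(4)] append_assoc[symmetric]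
    by (rule Q_compare) (use assms empty_notin_seg[OF ne] in auto)
qed

lemma qseq_pos: "(\<And>i. S i \<noteq> {}) \<Longrightarrow> 0 < qseq S n"
  unfolding qseq_def by (intro Q_pos empty_notin_seg) auto

lemma Q_le_1:
  assumes "{} \<notin> set Xs"
  shows "Q k S Xs v \<le> 1"
proof -
  have "\<T> (Xs @ S # replicate k UNIV) v \<le> \<T> (Xs @ UNIV # replicate k UNIV) v"
    unfolding transfer_append'[of f Xs]
    by (intro transfer_mono) (auto intro!: sum_mono2 mult_nonneg_nonneg transfer_nonneg)
  then show ?thesis
    unfolding Q_def using \<T>_pos[of "Xs @ UNIV # replicate k UNIV" v] assms
    by (simp del: transfer.simps)
qed

lemma qseq_compare:
  assumes "\<And>i. S i \<noteq> {}" "m * r \<le> n" "m * r \<le> n'"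
  shows "qseq S n \<le> (1 + rate m r)\<^sup>2 * qseq S n'"
  unfolding qseq_def using Q_compare_seg(2)[of S "[]" m r n' n n' n] assms by simp

lemma qseq_tendsto:
  assumes ne: "\<And>i. S i \<noteq> {}"
  shows "qseq S \<longlonglongrightarrow> qinf S"
proof -
  have "Cauchy (qseq S)"
    unfolding Cauchy_def
  proof (intro allI impI)
    fix e :: real assume "e > 0"
    then obtain m r where \<rho>: "(1 + rate m r)\<^sup>2 \<le> 1 + e / 2" using rate_small[of "e / 2"] by auto
    have *: "qseq S n - qseq S n' < e" if "m * r \<le> n" "m * r \<le> n'" for n n'
    proof -
      have 1: "0 < qseq S n'" "qseq S n' \<le> 1"
        using qseq_pos[OF ne] Q_le_1 ne by (auto simp: qseq_def empty_notin_seg)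
      have "qseq S n \<le> (1 + rate m r)\<^sup>2 * qseq S n'" using ne that by (rule qseq_compare)
      also have "\<dots> \<le> (1 + e / 2) * qseq S n'" using \<rho> 1 by (intro mult_right_mono) auto
      also have "\<dots> \<le> qseq S n' + e / 2" using 1 \<open>e > 0\<close> by (simp add: algebra_simps)
      finally show ?thesis using \<open>e > 0\<close> by linarith
    qed
    show "\<exists>M. \<forall>i\<ge>M. \<forall>j\<ge>M. dist (qseq S i) (qseq S j) < e"
      by (intro exI[of _ "m * r"]) (use * in \<open>auto simp: dist_real_def abs_less_iff\<close>)
  qed
  then show ?thesis
    unfolding qinf_def using Cauchy_convergent_iff convergent_LIMSEQ_iff by blast
qed

lemma Q_qinf:
  assumes ne: "\<And>i. S i \<noteq> {}" and "{} \<notin> set Xs" "m * r \<le> n" "m * r \<le> k"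
  shows "Q k (S 0) (Xs @ seg S 1 (Suc n)) v \<le> (1 + rate m r)\<^sup>2 * qinf S"
    and "qinf S \<le> (1 + rate m r)\<^sup>2 * Q k (S 0) (Xs @ seg S 1 (Suc n)) v"
proof -
  have ev: "eventually (\<lambda>n. m * r \<le> n) sequentially" by (rule eventually_ge_at_top)
  show "Q k (S 0) (Xs @ seg S 1 (Suc n)) v \<le> (1 + rate m r)\<^sup>2 * qinf S"
  proof (rule tendsto_lowerbound)
    show "(\<lambda>j. (1 + rate m r)\<^sup>2 * qseq S j) \<longlonglongrightarrow> (1 + rate m r)\<^sup>2 * qinf S"
      by (intro tendsto_intros qseq_tendsto ne)
    show "\<forall>\<^sub>F j in sequentially. Q k (S 0) (Xs @ seg S 1 (Suc n)) v \<le> (1 + rate m r)\<^sup>2 * qseq S j"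
      using ev by eventually_elim (use assms in \<open>auto simp: qseq_def intro!: Q_compare_seg(1)[simplified]\<close>)
  qed simp
  show "qinf S \<le> (1 + rate m r)\<^sup>2 * Q k (S 0) (Xs @ seg S 1 (Suc n)) v"
  proof (rule tendsto_upperbound)
    show "qseq S \<longlonglongrightarrow> qinf S"
      by (intro tendsto_intros qseq_tendsto ne)
    show "\<forall>\<^sub>F j in sequentially. qseq S j \<le> (1 + rate m r)\<^sup>2 * Q k (S 0) (Xs @ seg S 1 (Suc n)) v"
      using ev by eventually_elim (use assms in \<open>auto simp: qseq_def intro!: Q_compare_seg(2)[simplified]\<close>)
  qed simp
qed

lemma qinf_pos:
  assumes ne: "\<And>i. S i \<noteq> {}"
  shows "0 < qinf S"
proof -
  have "0 < Q 0 (S 0) ([] @ seg S 1 (Suc 0)) undefined"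
    using ne by (intro Q_pos) (auto simp: empty_notin_seg)
  \<comment> \<open>Zero blocks give a crude but finite comparison constant, which suffices for
    positivity.\<close>
  also have "\<dots> \<le> (1 + rate 0 0)\<^sup>2 * qinf S" by (rule Q_qinf) (use ne in auto)
  finally show ?thesis using rate_nonneg[of 0 0] by (simp add: zero_less_mult_iff)
qed

text \<open>Before the limit both sides have the same left margin, so only the comparison on the
  right is paid: one factor \<open>1 + rate m r\<close> in place of its square. The variations of
  \<open>phi\<close> are estimated from this.\<close>

lemma qinf_compare:
  assumes ne: "\<And>i. S i \<noteq> {}" "\<And>i. S' i \<noteq> {}" and eq: "\<And>i. i \<le> n \<Longrightarrow> S i = S' i" and "m * r \<le> n"
  shows "qinf S \<le> (1 + rate m r) * qinf S'"
proof (rule tendsto_le)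
  show "qseq S \<longlonglongrightarrow> qinf S" "(\<lambda>j. (1 + rate m r) * qseq S' j) \<longlonglongrightarrow> (1 + rate m r) * qinf S'"
    by (intro tendsto_intros qseq_tendsto ne)+
  show "\<forall>\<^sub>F j in sequentially. qseq S j \<le> (1 + rate m r) * qseq S' j"
    using eventually_ge_at_top[of n]
  proof eventually_elim
    case (elim j)
    have *: "seg S 1 (Suc j) = seg S (Suc n) (Suc j) @ seg S 1 (Suc n)" for S :: "nat \<Rightarrow> 'a set"
      using elim by (intro seg_split) auto
    have eqs: "seg S 1 (Suc n) = seg S' 1 (Suc n)" "S 0 = S' 0"
      using eq by (auto intro!: seg_cong)
    show ?case
      unfolding qseq_def * eqs
      by (rule Q_right) (use assms empty_notin_seg[OF ne(1)] empty_notin_seg[OF ne(2)] in auto)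
  qed
qed simp

lemma Q_tendsto:
  assumes ne: "\<And>i. S i \<noteq> {}" and "\<And>t. {} \<notin> set (Xs t)"
    and \<kappa>: "filterlim \<kappa> at_top F" and N: "filterlim N at_top F"
  shows "((\<lambda>t. Q (\<kappa> t) (S 0) (Xs t @ seg S 1 (Suc (N t))) v) \<longlongrightarrow> qinf S) F"
proof (rule tendsto_of_ratio_bounds)
  fix \<eta> :: real assume "\<eta> > 0"
  then obtain m r where \<rho>: "(1 + rate m r)\<^sup>2 \<le> 1 + \<eta>" using rate_small by blast
  have "eventually (\<lambda>t. m * r \<le> \<kappa> t) F" "eventually (\<lambda>t. m * r \<le> N t) F"
    using \<kappa> N by (auto simp: filterlim_at_top)
  then show "\<forall>\<^sub>F t in F. Q (\<kappa> t) (S 0) (Xs t @ seg S 1 (Suc (N t))) v \<le> (1 + \<eta>) * qinf S \<and>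
      qinf S \<le> (1 + \<eta>) * Q (\<kappa> t) (S 0) (Xs t @ seg S 1 (Suc (N t))) v"
  proof eventually_elim
    case (elim t)
    let ?q = "Q (\<kappa> t) (S 0) (Xs t @ seg S 1 (Suc (N t))) v"
    have "0 < ?q"
      using assms by (intro Q_pos) (auto simp: empty_notin_seg)
    then have "(1 + rate m r)\<^sup>2 * ?q \<le> (1 + \<eta>) * ?q" "(1 + rate m r)\<^sup>2 * qinf S \<le> (1 + \<eta>) * qinf S"
      using qinf_pos[OF ne] by (auto intro!: mult_right_mono \<rho> less_imp_le)
    moreover note Q_qinf[OF ne assms(2) elim(2,1), where v = v]
    ultimately show ?case by (meson order_trans)
  qed
qed (rule qinf_pos[OF ne])

end

section \<open>Uniqueness of stationary word weights\<close>

lemma sum_listset_Cons: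
  "(\<Sum>x\<in>listset (S # Ss). h x) = (\<Sum>s\<in>S. \<Sum>x\<in>listset Ss. h (s # x))"
proof -
  have "listset (S # Ss) = (\<lambda>(s, x). s # x) ` (S \<times> listset Ss)"
    by (auto simp: set_Cons_def)
  moreover have "inj_on (\<lambda>(s, x). s # x) (S \<times> listset Ss)"
    by (auto simp: inj_on_def)
  ultimately show ?thesis
    by (simp add: sum.reindex sum.cartesian_product case_prod_unfold)
qed

text \<open>Constraints are resolved into letters from left to right; in the induction
  \<open>y\<close> holds the letters already chosen.\<close>

lemma sum_listset_additive:
  assumes "\<And>Xs S Ys. {} \<notin> set (Xs @ S # Ys) \<Longrightarrow> G (Xs @ S # Ys) = (\<Sum>s\<in>S. G (Xs @ {s} # Ys))"
    and "{} \<notin> set Ss"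
  shows "(G Ss :: real) = (\<Sum>x\<in>listset Ss. G (map (\<lambda>s. {s}) x))"
proof -
  have "G (map (\<lambda>s. {s}) y @ Ss) = (\<Sum>x\<in>listset Ss. G (map (\<lambda>s. {s}) (y @ x)))" for y
    using assms(2)
  proof (induction Ss arbitrary: y)
    case Nil
    then show ?case by simp
  next
    case (Cons S Ss)
    have "G (map (\<lambda>s. {s}) y @ S # Ss) = (\<Sum>s\<in>S. G (map (\<lambda>s. {s}) (y @ [s]) @ Ss))"
      using assms(1)[of "map (\<lambda>s. {s}) y" S Ss] Cons.prems by auto
    also have "\<dots> = (\<Sum>s\<in>S. \<Sum>x\<in>listset Ss. G (map (\<lambda>s. {s}) (y @ s # x)))"
      using Cons by (intro sum.cong refl) (subst Cons.IH, auto)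
    finally show ?case by (simp only: sum_listset_Cons)
  qed
  from this[of "[]"] show ?thesis by simp
qed

abbreviation words :: "nat \<Rightarrow> 'a list set" where
  "words n \<equiv> listset (replicate n UNIV)"

lemma words_eq: "words n = {x. length x = n}"
  by (induction n) (auto simp: set_Cons_def length_Suc_conv)

lemma finite_words: "finite (words n :: 'a::finite list set)"
  unfolding words_eq using finite_lists_length_eq[of "UNIV :: 'a set" n] by simp

lemma sum_words_append:
  "(\<Sum>x\<in>words (n + m). h x) = (\<Sum>x\<in>words n. \<Sum>y\<in>words m. h (x @ y))"
  by (induction n arbitrary: h) (simp_all add: sum_listset_Cons del: listset.simps(2))

text \<open>The cylinder weights of an invariant probability measure: \<open>append\<close> is
  Kolmogorov consistency and \<open>Cons\<close> is invariance under the shift.\<close>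

locale stationary_word_weights =
  fixes \<mu> :: "'a::finite list \<Rightarrow> real"
  assumes nonneg: "0 \<le> \<mu> x"
    and Nil: "\<mu> [] = 1"
    and append: "(\<Sum>s\<in>UNIV. \<mu> (x @ [s])) = \<mu> x"
    and Cons: "(\<Sum>s\<in>UNIV. \<mu> (s # x)) = \<mu> x"
begin

lemma sum_right: "(\<Sum>y\<in>words m. \<mu> (x @ y)) = \<mu> x"
proof (induction m arbitrary: x)
  case (Suc m)
  have "(\<Sum>y\<in>words (Suc m). \<mu> (x @ y)) = (\<Sum>s\<in>UNIV. \<Sum>y\<in>words m. \<mu> ((x @ [s]) @ y))"
    by (simp only: replicate_Suc sum_listset_Cons) simp
  then show ?case by (simp only: Suc append)
qed simp

lemma sum_left: "(\<Sum>y\<in>words m. \<mu> (y @ x)) = \<mu> x"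
proof (induction m arbitrary: x)
  case (Suc m)
  have "(\<Sum>y\<in>words (Suc m). \<mu> (y @ x)) = (\<Sum>s\<in>UNIV. \<Sum>y\<in>words m. \<mu> (s # y @ x))"
    by (simp only: replicate_Suc sum_listset_Cons) simp
  also have "\<dots> = (\<Sum>y\<in>words m. \<mu> (y @ x))"
    by (subst sum.swap) (simp only: Cons)
  finally show ?case by (simp only: Suc)
qed simp

lemma sum_words: "(\<Sum>x\<in>words m. \<mu> x) = 1"
  using sum_right[of "[]"] Nil by simp

end

text \<open>An \<open>L\<^sup>2\<close> martingale argument. The energy \<open>D n\<close> of the density \<open>\<mu> / \<nu>\<close> on words of length \<open>n\<close> is
  increasing and bounded, so the density of a word of length \<open>2 n\<close> is close both to that of its
  first half and to that of its second half. Since the halves are almost independent under \<open>\<nu>\<close>,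
  the density is constant.\<close>

lemma stationary_word_weights_unique:
  assumes "stationary_word_weights \<mu>" "stationary_word_weights \<nu>"
    and pos: "\<And>x. 0 < \<nu> x" and dom: "\<And>x. \<mu> x \<le> K * \<nu> x"
    and mix: "\<And>x y. \<nu> x * \<nu> y \<le> M * \<nu> (x @ y)"
  shows "\<mu> x = \<nu> x"
proof -
  interpret \<mu>: stationary_word_weights \<mu> by fact
  interpret \<nu>: stationary_word_weights \<nu> by fact
  have "K \<ge> 0" "M \<ge> 0" using dom[of "[]"] mix[of "[]" "[]"] by (auto simp: \<mu>.Nil \<nu>.Nil)
  define \<rho> where "\<rho> x = \<mu> x / \<nu> x" for x
  have \<mu>: "\<mu> x = \<rho> x * \<nu> x" for x using pos[of x] by (simp add: \<rho>_def)
  have \<rho>: "0 \<le> \<rho> x" "\<rho> x \<le> K" for x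
    using pos[of x] dom[of x] \<mu>.nonneg[of x] by (auto simp: \<rho>_def divide_le_eq)
  define D where "D n = (\<Sum>x\<in>words n. \<nu> x * (\<rho> x)\<^sup>2)" for n
  have D0: "D 0 = 1" by (simp add: D_def \<rho>_def \<mu>.Nil \<nu>.Nil)
  \<comment> \<open>Pythagoras for a martingale: given the prefix \<open>x\<close>, the
    \<open>\<nu>\<close>-mean of \<open>\<rho> (x @ y)\<close> is \<open>\<rho> x\<close>.\<close>
  have right: "(\<Sum>x\<in>words n. \<Sum>y\<in>words m. \<nu> (x @ y) * (\<rho> (x @ y) - \<rho> x)\<^sup>2) = D (n + m) - D n" for n m
  proof -
    have "(\<Sum>y\<in>words m. \<nu> (x @ y) * (\<rho> (x @ y) - \<rho> x)\<^sup>2) =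
        (\<Sum>y\<in>words m. \<nu> (x @ y) * (\<rho> (x @ y))\<^sup>2) - \<nu> x * (\<rho> x)\<^sup>2" for x
    proof -
      have "(\<Sum>y\<in>words m. \<nu> (x @ y) * (\<rho> (x @ y) - \<rho> x)\<^sup>2) =
        (\<Sum>y\<in>words m. \<nu> (x @ y) * (\<rho> (x @ y))\<^sup>2 - 2 * \<rho> x * \<mu> (x @ y) + (\<rho> x)\<^sup>2 * \<nu> (x @ y))"
        by (rule sum.cong) (simp_all add: \<mu> power2_eq_square algebra_simps)
      also have "\<dots> = (\<Sum>y\<in>words m. \<nu> (x @ y) * (\<rho> (x @ y))\<^sup>2) - 2 * \<rho> x * \<mu> x + (\<rho> x)\<^sup>2 * \<nu> x"
        by (simp add: sum.distrib sum_subtractf \<mu>.sum_right \<nu>.sum_right flip: sum_distrib_left)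
      finally show ?thesis by (simp add: \<mu> power2_eq_square)
    qed
    then show ?thesis by (simp add: D_def sum_words_append sum_subtractf)
  qed
  \<comment> \<open>The same orthogonality with respect to the suffix; here invariance replaces
    consistency.\<close>
  have left: "(\<Sum>x\<in>words n. \<Sum>y\<in>words m. \<nu> (x @ y) * (\<rho> (x @ y) - \<rho> y)\<^sup>2) = D (n + m) - D m" for n m
  proof -
    have "(\<Sum>x\<in>words n. \<nu> (x @ y) * (\<rho> (x @ y) - \<rho> y)\<^sup>2) =
        (\<Sum>x\<in>words n. \<nu> (x @ y) * (\<rho> (x @ y))\<^sup>2) - \<nu> y * (\<rho> y)\<^sup>2" for y
    proof -
      have "(\<Sum>x\<in>words n. \<nu> (x @ y) * (\<rho> (x @ y) - \<rho> y)\<^sup>2) =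
        (\<Sum>x\<in>words n. \<nu> (x @ y) * (\<rho> (x @ y))\<^sup>2 - 2 * \<rho> y * \<mu> (x @ y) + (\<rho> y)\<^sup>2 * \<nu> (x @ y))"
        by (rule sum.cong) (simp_all add: \<mu> power2_eq_square algebra_simps)
      also have "\<dots> = (\<Sum>x\<in>words n. \<nu> (x @ y) * (\<rho> (x @ y))\<^sup>2) - 2 * \<rho> y * \<mu> y + (\<rho> y)\<^sup>2 * \<nu> y"
        by (simp add: sum.distrib sum_subtractf \<mu>.sum_left \<nu>.sum_left flip: sum_distrib_left)
      finally show ?thesis by (simp add: \<mu> power2_eq_square)
    qed
    then have "(\<Sum>y\<in>words m. \<Sum>x\<in>words n. \<nu> (x @ y) * (\<rho> (x @ y) - \<rho> y)\<^sup>2) =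
        (\<Sum>y\<in>words m. \<Sum>x\<in>words n. \<nu> (x @ y) * (\<rho> (x @ y))\<^sup>2) - D m"
      by (simp add: D_def sum_subtractf)
    moreover have "D (n + m) = (\<Sum>y\<in>words m. \<Sum>x\<in>words n. \<nu> (x @ y) * (\<rho> (x @ y))\<^sup>2)"
      unfolding D_def sum_words_append by (rule sum.swap)
    ultimately show ?thesis by (subst sum.swap) simp
  qed
  have mono: "D n \<le> D (n + m)" for n m
  proof -
    have "0 \<le> D (n + m) - D n" unfolding right[symmetric]
      by (intro sum_nonneg mult_nonneg_nonneg) (auto simp: pos less_imp_le)
    then show ?thesis by simp
  qed
  then have "incseq D" by (auto simp: incseq_def le_iff_add)
  have "D n \<le> K\<^sup>2" for n
  proof -
    have "D n \<le> (\<Sum>x\<in>words n. \<nu> x * K\<^sup>2)"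
      unfolding D_def by (intro sum_mono mult_left_mono power_mono) (auto simp: pos less_imp_le \<rho>)
    then show ?thesis by (simp add: \<nu>.sum_words flip: sum_distrib_right)
  qed
  with \<open>incseq D\<close> obtain L where L: "D \<longlonglongrightarrow> L" using incseq_convergent by blast
  \<comment> \<open>The variance of \<open>\<rho>\<close> on words of length \<open>n\<close> is
    \<open>D n - 1\<close>. Doubled, it is the mean square difference of two independent copies, and
    \<open>mix\<close> replaces these by the halves of one word at the price
    \<open>M\<close>.\<close>
  have est: "D n - 1 \<le> 2 * M * (D (n + n) - D n)" for n
  proof -
    have "2 * (D n - 1) = (\<Sum>x\<in>words n. \<Sum>y\<in>words n. \<nu> x * \<nu> y * (\<rho> x - \<rho> y)\<^sup>2)"
    proof -
      have "\<nu> x * \<nu> y * (\<rho> x - \<rho> y)\<^sup>2 = (\<nu> x * (\<rho> x)\<^sup>2) * \<nu> y - 2 * (\<mu> x * \<mu> y) + \<nu> x * (\<nu> y * (\<rho> y)\<^sup>2)" for x y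
        by (simp add: \<mu> power2_eq_square algebra_simps)
      then show ?thesis
        by (simp add: sum.distrib sum_subtractf \<mu>.sum_words \<nu>.sum_words flip: D_def sum_distrib_left sum_distrib_right)
    qed
    also have "\<dots> \<le> (\<Sum>x\<in>words n. \<Sum>y\<in>words n. 2 * M * (\<nu> (x @ y) * (\<rho> (x @ y) - \<rho> x)\<^sup>2)
        + 2 * M * (\<nu> (x @ y) * (\<rho> (x @ y) - \<rho> y)\<^sup>2))"
    proof (intro sum_mono)
      fix x y
      have "(\<rho> x - \<rho> y)\<^sup>2 \<le> 2 * (\<rho> (x @ y) - \<rho> x)\<^sup>2 + 2 * (\<rho> (x @ y) - \<rho> y)\<^sup>2"
        using sum_squares_ge_zero[of "(\<rho> (x @ y) - \<rho> x) + (\<rho> (x @ y) - \<rho> y)" 0]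
        by (simp add: power2_eq_square algebra_simps)
      then have "\<nu> x * \<nu> y * (\<rho> x - \<rho> y)\<^sup>2 \<le>
          (M * \<nu> (x @ y)) * (2 * (\<rho> (x @ y) - \<rho> x)\<^sup>2 + 2 * (\<rho> (x @ y) - \<rho> y)\<^sup>2)"
        using pos \<open>M \<ge> 0\<close> by (intro mult_mono[OF mix]) (auto simp: less_imp_le)
      then show "\<nu> x * \<nu> y * (\<rho> x - \<rho> y)\<^sup>2 \<le> 2 * M * (\<nu> (x @ y) * (\<rho> (x @ y) - \<rho> x)\<^sup>2)
        + 2 * M * (\<nu> (x @ y) * (\<rho> (x @ y) - \<rho> y)\<^sup>2)"
        by (simp add: algebra_simps)
    qed
    also have "\<dots> = 2 * (2 * M * (D (n + n) - D n))"
      by (simp add: sum.distrib right left flip: sum_distrib_left)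
    finally show ?thesis by simp
  qed
  have L2: "(\<lambda>n. D (n + n)) \<longlonglongrightarrow> L"
    using LIMSEQ_subseq_LIMSEQ[OF L, of "\<lambda>n. n + n"] by (simp add: strict_mono_def comp_def)
  have "L - 1 \<le> 2 * M * (L - L)"
  proof (rule LIMSEQ_le)
    show "(\<lambda>n. D n - 1) \<longlonglongrightarrow> L - 1" by (intro tendsto_diff L tendsto_const)
    show "(\<lambda>n. 2 * M * (D (n + n) - D n)) \<longlonglongrightarrow> 2 * M * (L - L)"
      by (intro tendsto_mult_left tendsto_diff L L2)
  qed (auto intro: est)
  then have "D n \<le> 1" for n
    using incseq_le[OF \<open>incseq D\<close> L, of n] by simp
  then have "(\<Sum>y\<in>words (length x). \<nu> y * (\<rho> y - 1)\<^sup>2) \<le> 0"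
  proof -
    have "(\<Sum>y\<in>words (length x). \<nu> y * (\<rho> y - 1)\<^sup>2) = (\<Sum>y\<in>words (length x). \<nu> y * (\<rho> y)\<^sup>2 - 2 * \<mu> y + \<nu> y)"
      by (rule sum.cong) (simp_all add: \<mu> power2_eq_square algebra_simps)
    also have "\<dots> = D (length x) - 1"
      by (simp add: sum.distrib sum_subtractf \<mu>.sum_words \<nu>.sum_words flip: D_def sum_distrib_left)
    finally show ?thesis using \<open>D (length x) \<le> 1\<close> by simp
  qed
  moreover have "\<nu> x * (\<rho> x - 1)\<^sup>2 \<le> (\<Sum>y\<in>words (length x). \<nu> y * (\<rho> y - 1)\<^sup>2)"
    by (rule member_le_sum) (auto simp: words_eq pos less_imp_le finite_words[unfolded words_eq])
  ultimately have "\<nu> x * (\<rho> x - 1)\<^sup>2 \<le> \<nu> x * 0" by simp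
  then have "(\<rho> x - 1)\<^sup>2 \<le> 0" using pos[of x] by (simp only: mult_le_cancel_left_pos)
  then show ?thesis using \<mu>[of x] by simp
qed

section \<open>The stationary weights of a potential\<close>

context summable_potential
begin

abbreviation partition_function :: "'a set list \<Rightarrow> real" ("\<Z>") where
  "\<Z> Xs \<equiv> \<T> Xs (\<lambda>_. undefined)"

abbreviation free :: "nat \<Rightarrow> 'a set list" where
  "free k \<equiv> replicate k UNIV"

definition prodq :: "(nat \<Rightarrow> 'a set) \<Rightarrow> nat \<Rightarrow> real" where
  "prodq S n = (\<Prod>j<n. qinf (\<lambda>i. S (i + j)))"

text \<open>Telescoping: the step from \<open>n\<close> to \<open>Suc n\<close> frees the constraint
  \<open>S n\<close>, which is a quotient \<open>Q\<close> with \<open>n + \<kappa> t\<close> free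
  letters on its left. The number of positions stays the same throughout.\<close>

lemma prodq_tendsto:
  assumes ne: "\<And>i. S i \<noteq> {}"
    and "filterlim \<kappa> at_top F" and N: "filterlim N at_top F"
  shows "((\<lambda>t. \<Z> (seg S 0 (N t) @ free (\<kappa> t)) / \<Z> (seg S n (N t) @ free (n + \<kappa> t))) \<longlongrightarrow> prodq S n) F"
proof (induction n)
  case 0
  have "\<Z> (seg S 0 (N t) @ free (\<kappa> t)) \<noteq> 0" for t
    using \<T>_pos[of "seg S 0 (N t) @ free (\<kappa> t)"] empty_notin_seg[OF ne] by (simp add: less_imp_neq[symmetric])
  then show ?case by (simp add: prodq_def)
next
  case (Suc n)
  have *: "((\<lambda>t. Q (n + \<kappa> t) (S (0 + n)) ([] @ seg (\<lambda>i. S (i + n)) 1 (Suc (N t - Suc n))) (\<lambda>_. undefined))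
      \<longlongrightarrow> qinf (\<lambda>i. S (i + n))) F"
  proof (rule Q_tendsto)
    show "filterlim (\<lambda>t. n + \<kappa> t) at_top F" 
      by (rule filterlim_at_top_mono[OF assms(2)]) auto
    show "filterlim (\<lambda>t. N t - Suc n) at_top F"
      using N by (rule filterlim_compose[OF filterlim_minus_const_nat_at_top])
  qed (use ne in auto)
  have ev: "eventually (\<lambda>t. Suc n \<le> N t) F"
    using N by (auto simp: filterlim_at_top)
  have "((\<lambda>t. \<Z> (seg S n (N t) @ free (n + \<kappa> t)) / \<Z> (seg S (Suc n) (N t) @ free (Suc n + \<kappa> t))) \<longlongrightarrow>
       qinf (\<lambda>i. S (i + n))) F"
    by (rule Lim_transform_eventually[OF *]) (use ev in eventually_elim, 
      auto simp: Q_def seg_shift seg_Suc_left[of n] simp del: transfer.simps)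
  from tendsto_mult[OF Suc.IH this] have
    "((\<lambda>t. \<Z> (seg S 0 (N t) @ free (\<kappa> t)) / \<Z> (seg S n (N t) @ free (n + \<kappa> t)) *
      (\<Z> (seg S n (N t) @ free (n + \<kappa> t)) / \<Z> (seg S (Suc n) (N t) @ free (Suc n + \<kappa> t)))) \<longlongrightarrow> prodq S (Suc n)) F"
    by (simp add: prodq_def mult.commute del: transfer.simps)
  moreover have "\<Z> (seg S n (N t) @ free (n + \<kappa> t)) \<noteq> 0" for t
    using \<T>_pos[of "seg S n (N t) @ free (n + \<kappa> t)"] empty_notin_seg[OF ne] by (simp add: less_imp_neq[symmetric])
  ultimately show ?case by simp
qed

definition rel_weight :: "'a set list \<Rightarrow> real" where
  "rel_weight Xs = \<Z> Xs / \<Z> (free (length Xs))"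

lemma rel_weight_pos: "{} \<notin> set Xs \<Longrightarrow> 0 < rel_weight Xs"
  unfolding rel_weight_def by (intro divide_pos_pos \<T>_pos) auto

lemma \<Z>_splits:
  assumes "{} \<notin> set Xs" "{} \<notin> set Ys" "{} \<notin> set Us"
  shows "\<Z> (Us @ Xs @ Ys) \<le> exp (2 * tail 0) * (\<Z> Us * \<Z> Xs * \<Z> Ys)"
    and "\<Z> Us * \<Z> Xs * \<Z> Ys \<le> exp (2 * tail 0) * \<Z> (Us @ Xs @ Ys)"
proof -
  have pos: "0 < \<Z> Us" "0 < \<Z> Xs" "0 < \<Z> Ys" using assms by (auto intro: \<T>_pos)
  have "\<Z> (Us @ Xs @ Ys) \<le> exp (tail 0) * \<Z> Us * \<Z> (Xs @ Ys)"
    using assms by (intro \<T>_append_le) auto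
  also have "\<dots> \<le> exp (tail 0) * \<Z> Us * (exp (tail 0) * \<Z> Xs * \<Z> Ys)"
    using assms pos by (intro mult_left_mono \<T>_append_le) auto
  finally show "\<Z> (Us @ Xs @ Ys) \<le> exp (2 * tail 0) * (\<Z> Us * \<Z> Xs * \<Z> Ys)"
    by (simp add: exp_double power2_eq_square mult_ac)
  have "\<Z> Us * (\<Z> Xs * \<Z> Ys) \<le> \<Z> Us * (exp (tail 0) * \<Z> (Xs @ Ys))"
    using assms pos by (intro mult_left_mono \<T>_append_ge) auto
  also have "\<dots> = exp (tail 0) * (\<Z> Us * \<Z> (Xs @ Ys))" by simp
  also have "\<dots> \<le> exp (tail 0) * (exp (tail 0) * \<Z> (Us @ Xs @ Ys))"
    using assms by (intro mult_left_mono \<T>_append_ge) auto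
  finally show "\<Z> Us * \<Z> Xs * \<Z> Ys \<le> exp (2 * tail 0) * \<Z> (Us @ Xs @ Ys)"
    by (simp add: exp_double power2_eq_square mult_ac)
qed

text \<open>Isolating \<open>Xs\<close> takes two cuts in the numerator and two in the denominator,
  each costing \<open>exp (tail 0)\<close>.\<close>

lemma ratio_rel_weight:
  assumes "{} \<notin> set Xs" "{} \<notin> set Us"
  shows "\<Z> (Us @ Xs @ free k) / \<Z> (Us @ free (length Xs + k)) \<le> exp (4 * tail 0) * rel_weight Xs"
    and "rel_weight Xs \<le> exp (4 * tail 0) * (\<Z> (Us @ Xs @ free k) / \<Z> (Us @ free (length Xs + k)))"
proof -
  let ?F = "free (length Xs)" and ?E = "exp (2 * tail 0)"
  have free: "free (length Xs + k) = ?F @ free k" by (rule replicate_add)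
  have F: "{} \<notin> set ?F" "{} \<notin> set (free k)" by auto
  define u x y z where "u = \<Z> Us" and "x = \<Z> Xs" and "y = \<Z> (free k)" and "z = \<Z> ?F"
  define a b where "a = \<Z> (Us @ Xs @ free k)" and "b = \<Z> (Us @ ?F @ free k)"
  have pos: "0 < u" "0 < x" "0 < y" "0 < z" "0 < a" "0 < b"
    unfolding u_def x_def y_def z_def a_def b_def using assms F by (auto intro!: \<T>_pos)
  note 1 = \<Z>_splits[OF assms(1) F(2) assms(2), folded u_def x_def y_def a_def]
  note 2 = \<Z>_splits[OF F(1,2) assms(2), folded u_def z_def y_def b_def]
  have E: "exp (4 * tail 0) = ?E * ?E" by (simp flip: exp_add)
  have "a * (u * z * y) \<le> (?E * (u * x * y)) * (?E * b)"
    using pos by (intro mult_mono[OF 1(1) 2(2)]) auto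
  then have "(u * y) * (a * z) \<le> (u * y) * (?E * ?E * x * b)" by (simp add: mult_ac)
  then have "a * z \<le> ?E * ?E * x * b" using pos by simp
  then show "\<Z> (Us @ Xs @ free k) / \<Z> (Us @ free (length Xs + k)) \<le> exp (4 * tail 0) * rel_weight Xs"
    unfolding free a_def[symmetric] b_def[symmetric] rel_weight_def x_def[symmetric] z_def[symmetric] E
    using pos by (simp add: field_simps)
  have "(u * x * y) * b \<le> (?E * a) * (?E * (u * z * y))"
    using pos by (intro mult_mono[OF 1(2) 2(1)]) auto
  then have "(u * y) * (x * b) \<le> (u * y) * (?E * ?E * a * z)" by (simp add: mult_ac)
  then have "x * b \<le> ?E * ?E * a * z" using pos by simp
  then show "rel_weight Xs \<le> exp (4 * tail 0) * (\<Z> (Us @ Xs @ free k) / \<Z> (Us @ free (length Xs + k)))"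
    unfolding free a_def[symmetric] b_def[symmetric] rel_weight_def x_def[symmetric] z_def[symmetric] E
    using pos by (simp add: field_simps)
qed

lemma prodq_rel_weight:
  assumes ne: "\<And>i. S i \<noteq> {}"
  shows "prodq S n \<le> exp (4 * tail 0) * rel_weight (seg S 0 n)"
    and "rel_weight (seg S 0 n) \<le> exp (4 * tail 0) * prodq S n"
proof -
  have lim: "(\<lambda>t. \<Z> (seg S 0 t @ free t) / \<Z> (seg S n t @ free (n + t))) \<longlonglongrightarrow> prodq S n"
    using ne by (intro prodq_tendsto) (auto simp: filterlim_ident)
  have ev: "eventually (\<lambda>t. n \<le> t) sequentially" by (rule eventually_ge_at_top)
  have bnd: "\<Z> (seg S 0 t @ free t) / \<Z> (seg S n t @ free (n + t)) \<le> exp (4 * tail 0) * rel_weight (seg S 0 n)"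
    "rel_weight (seg S 0 n) \<le> exp (4 * tail 0) * (\<Z> (seg S 0 t @ free t) / \<Z> (seg S n t @ free (n + t)))"
    if "n \<le> t" for t
    using ratio_rel_weight[of "seg S 0 n" "seg S n t" t] empty_notin_seg[OF ne] seg_split[of 0 n t S] that by auto
  show "prodq S n \<le> exp (4 * tail 0) * rel_weight (seg S 0 n)"
    by (rule tendsto_upperbound[OF lim]) (rule eventually_mono[OF ev], erule bnd, simp)
  show "rel_weight (seg S 0 n) \<le> exp (4 * tail 0) * prodq S n"
    by (rule tendsto_lowerbound[OF tendsto_mult_left[OF lim]]) (rule eventually_mono[OF ev], erule bnd, simp)
qed

text \<open>The weight of the set of words \<open>listset Ss\<close> under the stationary measure with potential \<open>f\<close>.\<close>

definition pad :: "'a set list \<Rightarrow> nat \<Rightarrow> 'a set" where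
  "pad Ss i = (if i < length Ss then Ss ! i else UNIV)"

definition nu :: "'a set list \<Rightarrow> real" where
  "nu Ss = prodq (pad Ss) (length Ss)"

lemma pad_ne: "{} \<notin> set Ss \<Longrightarrow> pad Ss i \<noteq> {}"
  by (auto simp: pad_def) (metis nth_mem)

lemma seg_pad: "seg (pad Ss) 0 (length Ss + l) = free l @ rev Ss"
proof -
  have "map (pad Ss) [0..<length Ss + l] = Ss @ free l"
    by (rule nth_equalityI) (auto simp: pad_def nth_append)
  then show ?thesis by (simp add: seg_def)
qed

lemma nu_Nil: "nu [] = 1"
  by (simp add: nu_def prodq_def)

text \<open>The weight of \<open>S\<close> conditioned on \<open>Ss\<close> is a value of
  \<open>qinf\<close>, exactly and at every finite length. This is what identifies the quotients of
  cylinder measures that define the potential.\<close>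

lemma nu_Cons: "nu (S # Ss) = qinf (pad (S # Ss)) * nu Ss"
proof -
  have "(\<lambda>i. pad (S # Ss) (i + Suc j)) = (\<lambda>i. pad Ss (i + j))" for j
    by (rule ext) (simp add: pad_def)
  then show ?thesis
    unfolding nu_def prodq_def length_Cons prod.lessThan_Suc_shift by simp
qed

lemma nu_pos: "{} \<notin> set Ss \<Longrightarrow> 0 < nu Ss"
  unfolding nu_def prodq_def by (intro prod_pos qinf_pos ballI pad_ne)

text \<open>Past the end of the list \<open>pad\<close> imposes nothing, so the denominator in
  \<open>prodq_tendsto\<close> is a free partition function. Thus \<open>nu\<close> is a
  thermodynamic limit, from which its additivity and invariance can be read off.\<close>

lemma nu_tendsto:
  assumes "{} \<notin> set Ss" "filterlim \<kappa> at_top F" "filterlim l at_top F"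
  shows "((\<lambda>t. \<Z> (free (l t) @ rev Ss @ free (\<kappa> t)) / \<Z> (free (l t + length Ss + \<kappa> t))) \<longlongrightarrow> nu Ss) F"
proof -
  have "((\<lambda>t. \<Z> (seg (pad Ss) 0 (length Ss + l t) @ free (\<kappa> t)) /
      \<Z> (seg (pad Ss) (length Ss) (length Ss + l t) @ free (length Ss + \<kappa> t))) \<longlongrightarrow> nu Ss) F"
    unfolding nu_def
  proof (intro prodq_tendsto pad_ne assms)
    show "filterlim (\<lambda>t. length Ss + l t) at_top F" 
      by (rule filterlim_at_top_mono[OF assms(3)]) auto
  qed
  moreover have "seg (pad Ss) (length Ss) (length Ss + l) = free l" for l
    unfolding seg_def by (rule nth_equalityI) (auto simp: pad_def rev_nth)
  ultimately show ?thesis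
    by (simp add: seg_pad add.assoc flip: replicate_add)
qed

text \<open>The offsets allow one free letter to be counted either as part of a margin or as a
  constraint \<open>UNIV\<close>; uniqueness of limits then gives the two laws that follow.\<close>

lemma nu_lim:
  assumes "{} \<notin> set Ss"
  shows "(\<lambda>t. \<Z> (free (t + l) @ rev Ss @ free (t + k)) / \<Z> (free (t + l + length Ss + (t + k)))) \<longlonglongrightarrow> nu Ss"
  using assms by (intro nu_tendsto filterlim_add_const_nat_at_top)

lemma nu_free_right:
  assumes "{} \<notin> set Ss"
  shows "nu (Ss @ [UNIV]) = nu Ss"
proof (rule LIMSEQ_unique)
  show "(\<lambda>t. \<Z> (free (t + 1) @ rev Ss @ free (t + 0)) / \<Z> (free (t + 1 + length Ss + (t + 0)))) \<longlonglongrightarrow> nu Ss"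
    using assms by (rule nu_lim)
  have "(\<lambda>t. \<Z> (free (t + 0) @ rev (Ss @ [UNIV]) @ free (t + 0)) / \<Z> (free (t + 0 + length (Ss @ [UNIV]) + (t + 0)))) \<longlonglongrightarrow> nu (Ss @ [UNIV])"
    using assms by (intro nu_lim) auto
  then show "(\<lambda>t. \<Z> (free (t + 1) @ rev Ss @ free (t + 0)) / \<Z> (free (t + 1 + length Ss + (t + 0)))) \<longlonglongrightarrow> nu (Ss @ [UNIV])"
    by (simp add: replicate_append_same del: transfer.simps flip: replicate_Suc)
      (simp flip: replicate_append_same)
qed

lemma nu_free_left:
  assumes "{} \<notin> set Ss"
  shows "nu (UNIV # Ss) = nu Ss"
proof (rule LIMSEQ_unique)
  show "(\<lambda>t. \<Z> (free (t + 0) @ rev Ss @ free (t + 1)) / \<Z> (free (t + 0 + length Ss + (t + 1)))) \<longlonglongrightarrow> nu Ss"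
    using assms by (rule nu_lim)
  have "(\<lambda>t. \<Z> (free (t + 0) @ rev (UNIV # Ss) @ free (t + 0)) / \<Z> (free (t + 0 + length (UNIV # Ss) + (t + 0)))) \<longlonglongrightarrow> nu (UNIV # Ss)"
    using assms by (intro nu_lim) auto
  then show "(\<lambda>t. \<Z> (free (t + 0) @ rev Ss @ free (t + 1)) / \<Z> (free (t + 0 + length Ss + (t + 1)))) \<longlonglongrightarrow> nu (UNIV # Ss)"
    by (simp del: transfer.simps)
qed

lemma nu_split_set:
  assumes "{} \<notin> set (Xs @ S # Ys)"
  shows "nu (Xs @ S # Ys) = (\<Sum>s\<in>S. nu (Xs @ {s} # Ys))"
proof (rule LIMSEQ_unique)
  show "(\<lambda>t. \<Z> (free (t + 0) @ rev (Xs @ S # Ys) @ free (t + 0)) / \<Z> (free (t + 0 + length (Xs @ S # Ys) + (t + 0)))) \<longlonglongrightarrow> nu (Xs @ S # Ys)"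
    using assms by (rule nu_lim)
  have "(\<lambda>t. \<Sum>s\<in>S. \<Z> (free (t + 0) @ rev (Xs @ {s} # Ys) @ free (t + 0)) / \<Z> (free (t + 0 + length (Xs @ {s} # Ys) + (t + 0)))) \<longlonglongrightarrow> (\<Sum>s\<in>S. nu (Xs @ {s} # Ys))"
    using assms by (intro tendsto_sum nu_lim) auto
  moreover have "(\<Sum>s\<in>S. \<Z> (free (t + 0) @ rev (Xs @ {s} # Ys) @ free (t + 0)) / \<Z> (free (t + 0 + length (Xs @ {s} # Ys) + (t + 0))))
    = \<Z> (free (t + 0) @ rev (Xs @ S # Ys) @ free (t + 0)) / \<Z> (free (t + 0 + length (Xs @ S # Ys) + (t + 0)))" for t
    using transfer_split_set[of f "free t @ rev Ys" S "rev Xs @ free t" "\<lambda>_. 1" "\<lambda>_. undefined"]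
    by (simp add: sum_divide_distrib[symmetric] del: transfer.simps)
  ultimately show "(\<lambda>t. \<Z> (free (t + 0) @ rev (Xs @ S # Ys) @ free (t + 0)) / \<Z> (free (t + 0 + length (Xs @ S # Ys) + (t + 0)))) \<longlonglongrightarrow> (\<Sum>s\<in>S. nu (Xs @ {s} # Ys))"
    by (simp only:)
qed

lemma nu_rel_weight:
  assumes "{} \<notin> set Ss"
  shows "nu Ss \<le> exp (4 * tail 0) * rel_weight (rev Ss)"
    and "rel_weight (rev Ss) \<le> exp (4 * tail 0) * nu Ss"
  using prodq_rel_weight[of "pad Ss" "length Ss"] assms seg_pad[of Ss 0] by (auto simp: nu_def pad_ne)

definition nuw :: "'a list \<Rightarrow> real" where
  "nuw x = nu (map (\<lambda>s. {s}) x)"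

lemma singletons_ne: "{} \<notin> set (map (\<lambda>s. {s}) x)"
  by auto

lemma nuw_pos: "0 < nuw x"
  unfolding nuw_def by (rule nu_pos) auto

lemma stationary_nuw: "stationary_word_weights nuw"
proof
  show "0 \<le> nuw x" for x using nuw_pos[of x] by simp
  show "nuw [] = 1" by (simp add: nuw_def nu_Nil)
  show "(\<Sum>s\<in>UNIV. nuw (x @ [s])) = nuw x" for x
    using nu_split_set[of "map (\<lambda>s. {s}) x" UNIV "[]"] nu_free_right[OF singletons_ne, of x]
    by (simp add: nuw_def image_iff)
  show "(\<Sum>s\<in>UNIV. nuw (s # x)) = nuw x" for x
    using nu_split_set[of "[]" UNIV "map (\<lambda>s. {s}) x"] nu_free_left[OF singletons_ne, of x]
    by (simp add: nuw_def image_iff)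
qed

lemma nu_eq_sum_nuw:
  assumes "{} \<notin> set Ss"
  shows "nu Ss = (\<Sum>x\<in>listset Ss. nuw x)"
  unfolding nuw_def by (rule sum_listset_additive[OF nu_split_set assms])

text \<open>The exponent 14 is 4 + 4 for passing to relative weights, 2 for one cut in the numerator
  and one in the denominator, and 4 for passing back.\<close>

lemma nuw_mix: "nuw x * nuw y \<le> exp (14 * tail 0) * nuw (x @ y)"
proof -
  let ?s = "map (\<lambda>s. {s}) :: 'a list \<Rightarrow> 'a set list"
  let ?E = "exp (4 * tail 0)"
  have w: "0 < rel_weight (rev (?s x))" for x by (rule rel_weight_pos) auto
  have b: "nuw x \<le> ?E * rel_weight (rev (?s x))" "rel_weight (rev (?s x)) \<le> ?E * nuw x" for x
    using nu_rel_weight[OF singletons_ne, of x] by (auto simp: nuw_def)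
  let ?X = "rev (?s x)" and ?Y = "rev (?s y)" and ?n = "length x" and ?m = "length y"
  have rw: "rel_weight ?X * rel_weight ?Y \<le> exp (2 * tail 0) * rel_weight (?Y @ ?X)"
  proof -
    have pos: "0 < \<Z> (free k)" for k by (rule \<T>_pos) auto
    have "\<Z> ?Y * \<Z> ?X \<le> exp (tail 0) * \<Z> (?Y @ ?X)" by (rule \<T>_append_ge) auto
    moreover have "\<Z> (free ?m @ free ?n) \<le> exp (tail 0) * \<Z> (free ?m) * \<Z> (free ?n)"
      by (rule \<T>_append_le) auto
    ultimately have "(\<Z> ?Y * \<Z> ?X) * \<Z> (free ?m @ free ?n) \<le>
       (exp (tail 0) * \<Z> (?Y @ ?X)) * (exp (tail 0) * \<Z> (free ?m) * \<Z> (free ?n))"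
      using \<T>_pos[of "?Y @ ?X"] \<T>_pos[of "free ?m @ free ?n"]
      by (elim mult_mono) (simp_all add: image_iff less_imp_le)
    then have "(\<Z> ?Y * \<Z> ?X) * \<Z> (free (?m + ?n)) \<le> exp (2 * tail 0) * \<Z> (?Y @ ?X) * \<Z> (free ?m) * \<Z> (free ?n)"
      by (simp add: replicate_add exp_double power2_eq_square mult_ac)
    then show ?thesis
      using pos by (simp add: rel_weight_def field_simps)
  qed
  have "nuw x * nuw y \<le> (?E * rel_weight ?X) * (?E * rel_weight ?Y)"
    using nuw_pos w by (intro mult_mono b) (auto simp: less_imp_le)
  also have "\<dots> = ?E * ?E * (rel_weight ?X * rel_weight ?Y)" by simp
  also have "\<dots> \<le> ?E * ?E * (exp (2 * tail 0) * rel_weight (rev (?s (x @ y))))"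
    using rw by (intro mult_left_mono) auto
  also have "\<dots> \<le> ?E * ?E * (exp (2 * tail 0) * (?E * nuw (x @ y)))"
    by (intro mult_left_mono b) auto
  also have "\<dots> = (?E * ?E * exp (2 * tail 0) * ?E) * nuw (x @ y)" by simp
  also have "?E * ?E * exp (2 * tail 0) * ?E = exp (14 * tail 0)" by (simp flip: exp_add)
  finally show ?thesis .
qed

lemma nuw_unique:
  assumes "stationary_word_weights \<mu>" and "\<And>x. \<mu> x \<le> K * rel_weight (rev (map (\<lambda>s. {s}) x))"
  shows "\<mu> x = nuw x"
proof (rule stationary_word_weights_unique[OF assms(1) stationary_nuw])
  fix x
  have "0 < rel_weight (rev (map (\<lambda>s. {s}) x))" "0 \<le> \<mu> x"
    using assms(1) by (auto intro!: rel_weight_pos simp: stationary_word_weights_def)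
  with assms(2)[of x] have "0 \<le> K" by (smt (verit) mult_neg_pos)
  have "\<mu> x \<le> K * rel_weight (rev (map (\<lambda>s. {s}) x))" by fact
  also have "\<dots> \<le> K * (exp (4 * tail 0) * nuw x)"
    using \<open>0 \<le> K\<close> nu_rel_weight(2)[OF singletons_ne, of x] by (intro mult_left_mono) (auto simp: nuw_def)
  finally show "\<mu> x \<le> (K * exp (4 * tail 0)) * nuw x" by simp
qed (use nuw_pos nuw_mix in auto)

end

section \<open>Measures on sequence spaces\<close>

lemma in_cylinder_word: "b \<in> cylinder (word a 0 n) \<longleftrightarrow> (\<forall>i\<le>n. b i = a i)"
  by (auto simp: cylinder_def word_def map_eq_conv less_Suc_eq_le simp del: upt_Suc)

lemma word_eq_iff: "word a 0 n = word b 0 n \<longleftrightarrow> (\<forall>i\<le>n. a i = b i)"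
  by (simp add: word_def Ball_def less_Suc_eq_le del: upt_Suc)

lemma in_cylinder: "a \<in> cylinder x \<longleftrightarrow> (\<forall>i<length x. a i = x ! i)"
  unfolding cylinder_def mem_Collect_eq by (subst list_eq_iff_nth_eq) simp

lemma open_cylinder:
  fixes x :: "'a::discrete_topology list"
  shows "open (cylinder x)"
proof -
  have "open {a :: nat \<Rightarrow> 'a. a i = y}" for i and y :: 'a
  proof -
    have "open ((\<lambda>a :: nat \<Rightarrow> 'a. a i) -` {y})"
      by (rule open_vimage) (simp_all add: continuous_on_product_coordinates discrete_topology_class.open_discrete)
    then show ?thesis by (simp add: vimage_def)
  qed
  then have "open (\<Inter>i\<in>{..<length x}. {a. a i = x ! i})" by (intro open_INT) auto
  also have "\<dots> = cylinder x" by (auto simp: in_cylinder)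
  finally show ?thesis .
qed

lemma cylinder_in_open:
  fixes a :: "nat \<Rightarrow> 'a::discrete_topology"
  assumes "open U" "a \<in> U"
  obtains n where "cylinder (word a 0 n) \<subseteq> U"
proof -
  obtain X where X: "a \<in> Pi\<^sub>E UNIV X" "finite {i. X i \<noteq> UNIV}" "Pi\<^sub>E UNIV X \<subseteq> U"
    using product_topology_open_contains_basis[of "\<lambda>_. euclidean" UNIV U a] assms
    by (auto simp: open_fun_def)
  obtain n where n: "\<And>i. X i \<noteq> UNIV \<Longrightarrow> i \<le> n"
    using X(2) finite_nat_set_iff_bounded_le by auto
  have "cylinder (word a 0 n) \<subseteq> Pi\<^sub>E UNIV X"
  proof
    fix b assume b: "b \<in> cylinder (word a 0 n)"
    have "b i \<in> X i" for i
    proof (cases "X i = UNIV")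
      case False
      then have "b i = a i" using n b by (auto simp: in_cylinder_word)
      then show ?thesis using X(1) by auto
    qed simp
    then show "b \<in> Pi\<^sub>E UNIV X" by auto
  qed
  from that[OF subset_trans[OF this X(3)]] show thesis .
qed

lemma cylinder_sets: "cylinder x \<in> sets (borel :: (nat \<Rightarrow> 'a::discrete_topology) measure)"
  by (rule borel_open[OF open_cylinder])

lemma measurable_shift:
  "shift \<in> borel_measurable (borel :: (nat \<Rightarrow> 'a::discrete_topology) measure)"
proof (rule borel_measurable_continuous_onI, rule continuous_on_coordinatewise_then_product)
  show "continuous_on UNIV (\<lambda>a :: nat \<Rightarrow> 'a. shift a i)" for i
    unfolding shift_def by (rule continuous_on_product_coordinates)
qed

lemma measurable_amalgamation:
  "amalgamation (p :: 'a::discrete_topology \<Rightarrow> 'b::discrete_topology) \<in> borel_measurable borel"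
proof (rule borel_measurable_continuous_onI, rule continuous_on_coordinatewise_then_product)
  show "continuous_on UNIV (\<lambda>a. amalgamation p a i)" for i
    unfolding amalgamation_def
    by (rule continuous_on_compose2[OF Topological_Spaces.continuous_on_discrete continuous_on_product_coordinates]) auto
qed

lemma funpow_shift: "(shift ^^ n) a = (\<lambda>i. a (i + n))"
  by (induction n arbitrary: a) (auto simp: shift_def)

definition stationary :: "(nat \<Rightarrow> 'a::{finite,discrete_topology}) measure \<Rightarrow> bool" where
  "stationary \<mu> \<longleftrightarrow> sets \<mu> = sets borel \<and> prob_space \<mu> \<and> distr \<mu> borel shift = \<mu>"

lemma stationary_word_weights_measure:
  fixes \<mu> :: "(nat \<Rightarrow> 'a::{finite,discrete_topology}) measure"
  assumes "stationary \<mu>"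
  shows "stationary_word_weights (\<lambda>x. measure \<mu> (cylinder x))"
proof -
  have sets: "sets \<mu> = sets borel" and inv: "distr \<mu> borel shift = \<mu>" and "prob_space \<mu>"
    using assms by (auto simp: stationary_def)
  have space: "space \<mu> = UNIV" using sets_eq_imp_space_eq[OF sets] by simp
  interpret prob_space \<mu> by fact
  show ?thesis
  proof
    show "measure \<mu> (cylinder []) = 1"
      using prob_space space by (simp add: cylinder_def)
    show "(\<Sum>s\<in>UNIV. measure \<mu> (cylinder (x @ [s]))) = measure \<mu> (cylinder x)" for x
    proof -
      have "measure \<mu> (\<Union>s. cylinder (x @ [s])) = (\<Sum>s\<in>UNIV. measure \<mu> (cylinder (x @ [s])))"
        by (rule finite_measure_finite_Union)
          (auto simp: sets cylinder_sets disjoint_family_on_def in_cylinder nth_append less_Suc_eq)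
      moreover have "(\<Union>s. cylinder (x @ [s])) = cylinder x"
        by (auto simp: in_cylinder nth_append less_Suc_eq)
      ultimately show ?thesis by simp
    qed
    show "(\<Sum>s\<in>UNIV. measure \<mu> (cylinder (s # x))) = measure \<mu> (cylinder x)" for x
    proof -
      have "measure \<mu> (\<Union>s. cylinder (s # x)) = (\<Sum>s\<in>UNIV. measure \<mu> (cylinder (s # x)))"
        by (rule finite_measure_finite_Union)
          (auto simp: sets cylinder_sets disjoint_family_on_def in_cylinder nth_Cons split: nat.splits)
      moreover have "(\<Union>s. cylinder (s # x)) = shift -` cylinder x"
        by (auto simp: in_cylinder nth_Cons shift_def split: nat.splits)
      moreover have "measure (distr \<mu> borel shift) (cylinder x) = measure \<mu> (shift -` cylinder x \<inter> space \<mu>)"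
        by (rule measure_distr) (auto simp: cylinder_sets measurable_shift measurable_cong_sets[OF sets refl])
      ultimately show ?thesis by (simp add: space inv)
    qed
  qed simp
qed

section \<open>Cylinders under amalgamation\<close>

definition fib :: "('a \<Rightarrow> 'b) \<Rightarrow> 'b list \<Rightarrow> 'a set list" where
  "fib p bs = map (\<lambda>b. p -` {b}) bs"

lemma fib_ne: "surj p \<Longrightarrow> {} \<notin> set (fib p bs)"
proof
  assume "surj p" "{} \<in> set (fib p bs)"
  then obtain b where "p -` {b} = {}" by (auto simp: fib_def)
  moreover obtain a where "p a = b" using \<open>surj p\<close> by (metis surj_def)
  ultimately show False by auto
qed

lemma finite_listset: "finite (listset Ss :: 'a::finite list set)"
proof (rule finite_subset)
  show "listset Ss \<subseteq> words (length Ss)"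
    by (induction Ss) (auto simp: set_Cons_def)
qed (rule finite_words)

lemma measure_pushforward_cylinder:
  fixes \<mu> :: "(nat \<Rightarrow> 'a::{finite,discrete_topology}) measure"
    and p :: "'a \<Rightarrow> 'b::{finite,discrete_topology}"
  assumes "stationary \<mu>"
  shows "measure (pushforward p \<mu>) (cylinder bs) = (\<Sum>x\<in>listset (fib p bs). measure \<mu> (cylinder x))"
proof -
  have sets: "sets \<mu> = sets borel" and "prob_space \<mu>"
    using assms by (auto simp: stationary_def)
  interpret prob_space \<mu> by fact
  have fib: "x \<in> listset (fib p bs) \<longleftrightarrow> map p x = bs" for x
    by (induction bs arbitrary: x) (auto simp: fib_def set_Cons_def map_eq_Cons_conv)
  have "measure (pushforward p \<mu>) (cylinder bs) = measure \<mu> (amalgamation p -` cylinder bs \<inter> space \<mu>)"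
    unfolding pushforward_def
    by (rule measure_distr) (auto simp: cylinder_sets measurable_amalgamation measurable_cong_sets[OF sets refl])
  also have "amalgamation p -` cylinder bs \<inter> space \<mu> = (\<Union>x\<in>listset (fib p bs). cylinder x)"
  proof -
    have *: "amalgamation p a \<in> cylinder bs \<longleftrightarrow> (\<exists>x. map p x = bs \<and> a \<in> cylinder x)" for a
    proof
      assume "amalgamation p a \<in> cylinder bs"
      then have "map p (map a [0..<length bs]) = bs"
        by (simp add: cylinder_def amalgamation_def comp_def)
      moreover have "a \<in> cylinder (map a [0..<length bs])" by (simp add: cylinder_def)
      ultimately show "\<exists>x. map p x = bs \<and> a \<in> cylinder x" by blast
    next
      assume "\<exists>x. map p x = bs \<and> a \<in> cylinder x"
      then obtain x where x: "map p x = bs" "a \<in> cylinder x" by blast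
      then show "amalgamation p a \<in> cylinder bs"
        unfolding x(1)[symmetric] in_cylinder by (simp add: amalgamation_def)
    qed
    have "space \<mu> = UNIV" using sets_eq_imp_space_eq[OF sets] by simp
    moreover have "listset (fib p bs) = {x. map p x = bs}" using fib by blast
    ultimately show ?thesis unfolding vimage_def * by auto
  qed
  also have "measure \<mu> \<dots> = (\<Sum>x\<in>listset (fib p bs). measure \<mu> (cylinder x))"
  proof (rule finite_measure_finite_Union)
    show "finite (listset (fib p bs))" by (rule finite_listset)
    show "disjoint_family_on cylinder (listset (fib p bs))"
      unfolding disjoint_family_on_def
    proof (intro ballI impI)
      fix x y assume xy: "x \<in> listset (fib p bs)" "y \<in> listset (fib p bs)" "x \<noteq> y"
      then have "length x = length y" by (metis fib length_map)
      then show "cylinder x \<inter> cylinder y = {}" using \<open>x \<noteq> y\<close> by (auto simp: cylinder_def)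
    qed
  qed (auto simp: sets cylinder_sets)
  finally show ?thesis .
qed

lemma stationary_pushforward:
  fixes \<mu> :: "(nat \<Rightarrow> 'a::{finite,discrete_topology}) measure"
    and p :: "'a \<Rightarrow> 'b::{finite,discrete_topology}"
  assumes "stationary \<mu>"
  shows "stationary (pushforward p \<mu>)"
proof -
  have sets: "sets \<mu> = sets borel" and inv: "distr \<mu> borel shift = \<mu>" and "prob_space \<mu>"
    using assms by (auto simp: stationary_def)
  have m: "amalgamation p \<in> measurable \<mu> borel" "shift \<in> measurable \<mu> borel"
    by (auto simp: measurable_amalgamation measurable_shift measurable_cong_sets[OF sets refl])
  have "distr (distr \<mu> borel (amalgamation p)) borel shift = distr \<mu> borel (shift \<circ> amalgamation p)"
    by (rule distr_distr) (auto simp: measurable_shift m)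
  also have "shift \<circ> amalgamation p = amalgamation p \<circ> shift"
    by (auto simp: shift_def amalgamation_def)
  also have "distr \<mu> borel (amalgamation p \<circ> shift) = distr (distr \<mu> borel shift) borel (amalgamation p)"
    by (rule distr_distr[symmetric]) (auto simp: measurable_amalgamation m)
  finally have "distr (pushforward p \<mu>) borel shift = pushforward p \<mu>"
    by (simp add: inv pushforward_def)
  moreover have "prob_space (pushforward p \<mu>)"
    unfolding pushforward_def using \<open>prob_space \<mu>\<close> m(1) by (rule prob_space.prob_space_distr)
  ultimately show ?thesis by (simp add: stationary_def pushforward_def)
qed

definition conc :: "'a list \<Rightarrow> (nat \<Rightarrow> 'a) \<Rightarrow> nat \<Rightarrow> 'a" where
  "conc x v i = (if i < length x then x ! i else v (i - length x))"

lemma conc_snoc: "conc (x @ [s]) v = conc x (case_nat s v)"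
proof
  fix i
  show "conc (x @ [s]) v i = conc x (case_nat s v) i"
  proof (cases "i \<le> length x")
    case False
    then have "i - length x = Suc (i - Suc (length x))" by simp
    then show ?thesis using False by (simp add: conc_def)
  qed (auto simp: conc_def nth_append)
qed

text \<open>The dictionary between partition functions and the Birkhoff sums in the Gibbs
  bounds.\<close>

lemma transfer_singletons:
  "transfer f (rev (map (\<lambda>s. {s}) x)) \<Phi> v = exp (birkhoff_sum (length x) f (conc x v)) * \<Phi> (conc x v)"
proof (induction x arbitrary: v rule: rev_induct)
  case Nil
  then show ?case by (simp add: birkhoff_sum_def conc_def)
next
  case (snoc s x)
  have "(shift ^^ length x) (conc x (case_nat s v)) = case_nat s v"
    by (simp add: funpow_shift conc_def)
  then show ?case
    by (simp add: snoc conc_snoc birkhoff_sum_def exp_add)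
qed

context summable_potential
begin

lemma \<Z>_eq_sum: "{} \<notin> set Ss \<Longrightarrow> \<Z> (rev Ss) = (\<Sum>x\<in>listset Ss. \<Z> (rev (map (\<lambda>s. {s}) x)))"
proof (rule sum_listset_additive)
  show "\<Z> (rev (Xs @ S # Ys)) = (\<Sum>s\<in>S. \<Z> (rev (Xs @ {s} # Ys)))" for Xs S Ys
    using transfer_split_set[of f "rev Ys" S "rev Xs"] by simp
qed

end

text \<open>The constant \<open>P\<close> is eliminated by normalization: summing the Gibbs bounds
  over all words of length \<open>n\<close> confines
  \<open>exp (- real n * P) * \<Z> (free n)\<close> to the interval from \<open>inverse C\<close> to
  \<open>C\<close>. Each estimate therefore costs a second factor \<open>C\<close>.\<close>

lemma gibbs_rel_weight:
  fixes \<mu> :: "(nat \<Rightarrow> 'a::{finite,discrete_topology}) measure"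
  assumes "gibbs_measure \<mu> f" "summable_potential f w"
  shows "\<exists>K. \<forall>x. measure \<mu> (cylinder x) \<le> K * summable_potential.rel_weight f (rev (map (\<lambda>s. {s}) x)) \<and>
    summable_potential.rel_weight f (rev (map (\<lambda>s. {s}) x)) \<le> K * measure \<mu> (cylinder x)"
proof -
  interpret summable_potential f w by fact
  have "\<exists>C P :: real. C \<ge> 1 \<and> (\<forall>n a.
        inverse C \<le> measure \<mu> (cylinder (word a 0 n)) / exp (birkhoff_sum (n + 1) f a - real (n + 1) * P) \<and>
        measure \<mu> (cylinder (word a 0 n)) / exp (birkhoff_sum (n + 1) f a - real (n + 1) * P) \<le> C)"
    using assms(1) unfolding gibbs_measure_def by (elim conjE)
  then obtain C P where C: "C \<ge> 1" and
    gibbs: "\<And>n a. inverse C \<le> measure \<mu> (cylinder (word a 0 n)) / exp (birkhoff_sum (n + 1) f a - real (n + 1) * P)"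
      "\<And>n a. measure \<mu> (cylinder (word a 0 n)) / exp (birkhoff_sum (n + 1) f a - real (n + 1) * P) \<le> C"
    by auto
  have "stationary \<mu>" using assms(1) by (simp add: stationary_def gibbs_measure_def)
  then interpret \<mu>: stationary_word_weights "\<lambda>x. measure \<mu> (cylinder x)"
    by (rule stationary_word_weights_measure)
  let ?z = "\<lambda>x. \<Z> (rev (map (\<lambda>s. {s}) x))" and ?m = "\<lambda>x. measure \<mu> (cylinder x)"
  define e where "e n = exp (- real n * P)" for n
  have *: "?m x \<le> C * (e (length x) * ?z x) \<and> e (length x) * ?z x \<le> C * ?m x" for x
  \<comment> \<open>\<open>word a 0 n\<close> has \<open>n + 1\<close> letters, so the Gibbs bounds
    say nothing about the empty word.\<close>
  proof (cases x)
    case Nil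
    then show ?thesis using C by (simp add: e_def \<mu>.Nil)
  next
    case (Cons s y)
    let ?a = "conc x (\<lambda>_. undefined)"
    have x: "word ?a 0 (length y) = x"
      unfolding word_def Cons by (rule nth_equalityI) (auto simp: conc_def nth_append simp del: upt_Suc)
    have z: "exp (birkhoff_sum (length y + 1) f ?a - real (length y + 1) * P) = e (length x) * ?z x"
      unfolding transfer_singletons by (simp add: Cons e_def mult_exp_exp algebra_simps)
    have "0 < e (length x) * ?z x" unfolding z[symmetric] by simp
    then show ?thesis
      using gibbs[where n = "length y" and a = ?a] C unfolding x z by (simp add: field_simps)
  qed
  have main: "?m x \<le> (C * C) * rel_weight (rev (map (\<lambda>s. {s}) x)) \<and> rel_weight (rev (map (\<lambda>s. {s}) x)) \<le> (C * C) * ?m x" for x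
  proof -
    let ?n = "length x"
    have sum: "\<Z> (free n) = (\<Sum>x\<in>words n. ?z x)" for n
      using \<Z>_eq_sum[of "free n"] by simp
    have L: "?m y \<le> C * (e ?n * ?z y)" "e ?n * ?z y \<le> C * ?m y" if "y \<in> words ?n" for y
      using *[of y] that unfolding words_eq by auto
    have "(\<Sum>y\<in>words ?n. ?m y) \<le> (\<Sum>y\<in>words ?n. C * (e ?n * ?z y))"
      by (rule sum_mono) (rule L)
    then have 1: "1 \<le> C * (e ?n * \<Z> (free ?n))" by (simp add: \<mu>.sum_words sum flip: sum_distrib_left)
    have "(\<Sum>y\<in>words ?n. e ?n * ?z y) \<le> (\<Sum>y\<in>words ?n. C * ?m y)"
      by (rule sum_mono) (rule L)
    then have 2: "e ?n * \<Z> (free ?n) \<le> C" by (simp add: \<mu>.sum_words sum flip: sum_distrib_left)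
    have F: "0 < \<Z> (free ?n)" by (rule \<T>_pos) auto
    define r where "r = rel_weight (rev (map (\<lambda>s. {s}) x))"
    have r: "?z x = r * \<Z> (free ?n)" "0 < r" using F by (auto simp: r_def rel_weight_def intro!: divide_pos_pos \<T>_pos)
    have "?m x \<le> C * (e ?n * ?z x)" using * by blast
    also have "\<dots> = (C * r) * (e ?n * \<Z> (free ?n))" by (simp add: r)
    also have "\<dots> \<le> (C * r) * C" using 2 r C by (intro mult_left_mono) auto
    finally have up: "?m x \<le> (C * C) * r" by (simp add: mult_ac)
    have "r * 1 \<le> r * (C * (e ?n * \<Z> (free ?n)))" using 1 r by (intro mult_left_mono) auto
    also have "\<dots> = C * (e ?n * ?z x)" by (simp add: r)
    also have "\<dots> \<le> C * (C * ?m x)" using * C by (intro mult_left_mono) auto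
    finally show ?thesis using up by (simp add: r_def mult_ac)
  qed
  then show ?thesis by blast
qed

section \<open>The potential of the amalgamated measure\<close>

lemma cube_le:
  fixes \<eta> :: real
  assumes "\<eta> > 0"
  obtains x where "x > 0" "(1 + x) ^ 3 \<le> 1 + \<eta>"
proof
  define x where "x = min 1 (\<eta> / 7)"
  show "x > 0" using assms by (simp add: x_def)
  have "x \<le> 1" by (simp add: x_def)
  with \<open>x > 0\<close> have "x * x \<le> x * 1" "x * x * x \<le> x * 1 * 1"
    by (intro mult_mono; simp)+
  then have "(1 + x) ^ 3 \<le> 1 + 7 * x"
    by (simp add: power3_eq_cube algebra_simps)
  also have "\<dots> \<le> 1 + \<eta>" by (simp add: x_def)
  finally show "(1 + x) ^ 3 \<le> 1 + \<eta>" .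
qed

text \<open>The memory loss bound \<open>rate\<close> only depends on \<open>w\<close>, hence is uniform in \<open>t\<close>.\<close>

lemma qinf_tendsto:
  assumes f: "summable_potential f w" and g: "\<And>t. summable_potential (g t) w"
    and lim: "\<And>u. (\<lambda>t. g t u) \<longlonglongrightarrow> f u" and ne: "\<And>i. S i \<noteq> {}"
  shows "(\<lambda>t. summable_potential.qinf (g t) S) \<longlonglongrightarrow> summable_potential.qinf f S"
proof (rule tendsto_of_ratio_bounds)
  interpret f: summable_potential f w by fact
  interpret g: summable_potential "g t" w for t by (rule g)
  show "0 < f.qinf S" using ne by (rule f.qinf_pos)
  fix \<eta> :: real assume "\<eta> > 0"
  \<comment> \<open>One factor \<open>1 + x\<close> each for passing from \<open>g.qinf\<close> to
    \<open>g.qseq\<close>, on to \<open>f.qseq\<close>, and on to \<open>f.qinf\<close>.\<close>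
  then obtain x where x: "x > 0" "(1 + x) ^ 3 \<le> 1 + \<eta>" by (rule cube_le)
  obtain m r where \<rho>: "(1 + f.rate m r)\<^sup>2 \<le> 1 + x" using f.rate_small[OF x(1)] .
  define n where "n = m * r"
  have qf: "f.qseq S n \<le> (1 + x) * f.qinf S" "f.qinf S \<le> (1 + x) * f.qseq S n"
    using f.Q_qinf[of S "[]" m r n n "\<lambda>_. undefined"] ne f.qseq_pos[of S n] f.qinf_pos[of S] \<rho>
    unfolding f.qseq_def n_def by (auto intro: order_trans mult_right_mono less_imp_le)
  have qg: "g.qseq t S n \<le> (1 + x) * g.qinf t S" "g.qinf t S \<le> (1 + x) * g.qseq t S n" for t
    using g.Q_qinf[of S "[]" m r n n t "\<lambda>_. undefined"] ne g.qseq_pos[of S t n] g.qinf_pos[of S t] \<rho>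
    unfolding g.qseq_def n_def by (auto intro: order_trans mult_right_mono less_imp_le)
  have "(\<lambda>t. g.qseq t S n) \<longlonglongrightarrow> f.qseq S n"
    unfolding g.qseq_def f.qseq_def g.Q_def f.Q_def
  proof (intro tendsto_divide transfer_tendsto lim)
    have "0 < f.one_transfer (seg S 1 (Suc n) @ replicate (Suc n) UNIV) (\<lambda>_. undefined)"
      using empty_notin_seg[of S] ne by (intro f.\<T>_pos) auto
    then show "f.one_transfer (seg S 1 (Suc n) @ replicate (Suc n) UNIV) (\<lambda>_. undefined) \<noteq> 0" by linarith
  qed
  moreover have pos: "0 < f.qseq S n" by (rule f.qseq_pos[OF ne])
  then have "f.qseq S n < (1 + x) * f.qseq S n" "f.qseq S n / (1 + x) < f.qseq S n"
    using x by (auto simp: field_simps)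
  ultimately have "\<forall>\<^sub>F t in sequentially. g.qseq t S n < (1 + x) * f.qseq S n"
    "\<forall>\<^sub>F t in sequentially. f.qseq S n / (1 + x) < g.qseq t S n"
    by (auto dest: order_tendstoD)
  then show "\<forall>\<^sub>F t in sequentially. g.qinf t S \<le> (1 + \<eta>) * f.qinf S \<and> f.qinf S \<le> (1 + \<eta>) * g.qinf t S"
  proof eventually_elim
    case (elim t)
    have x1: "0 < 1 + x" using x by simp
    have "g.qinf t S \<le> (1 + x) * ((1 + x) * ((1 + x) * f.qinf S))"
      using qg(2)[of t] elim(1) qf(1) x1 by (smt (verit) mult_left_mono)
    also have "\<dots> = (1 + x) ^ 3 * f.qinf S" by (simp add: power3_eq_cube)
    also have "\<dots> \<le> (1 + \<eta>) * f.qinf S" using x f.qinf_pos[of S] ne by (intro mult_right_mono) (auto simp: less_imp_le)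
    finally have 1: "g.qinf t S \<le> (1 + \<eta>) * f.qinf S" .
    have "f.qseq S n < (1 + x) * g.qseq t S n" using elim(2) x1 by (simp add: field_simps)
    then have "f.qinf S \<le> (1 + x) * ((1 + x) * ((1 + x) * g.qinf t S))"
      using qg(1)[of t] qf(2) x1 by (smt (verit) mult_left_mono)
    also have "\<dots> = (1 + x) ^ 3 * g.qinf t S" by (simp add: power3_eq_cube)
    also have "\<dots> \<le> (1 + \<eta>) * g.qinf t S" using x g.qinf_pos[of S t] ne by (intro mult_right_mono) (auto simp: less_imp_le)
    finally show ?case using 1 by simp
  qed
qed

section \<open>Approximants share the majorant of the potential\<close>

context summable_potential
begin

lemma approximant_bounds: "f a \<le> approximant f r a" "approximant f r a \<le> f a + w r"
proof -
  have *: "f b \<le> f a + w r" if "b \<in> cylinder (word a 0 r)" for b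
    using var_le[of r a b] that by (fastforce simp: in_cylinder_word)
  have a: "a \<in> cylinder (word a 0 r)" by (simp add: in_cylinder_word)
  show "f a \<le> approximant f r a" unfolding approximant_def
    using a by (rule cSUP_upper) (use * in \<open>auto intro!: bdd_aboveI2[of _ _ "f a + w r"]\<close>)
  show "approximant f r a \<le> f a + w r" unfolding approximant_def
    using a * by (intro cSUP_least) auto
qed

lemma approximant_tendsto: "(\<lambda>r. approximant f r a) \<longlonglongrightarrow> f a"
proof (rule tendsto_sandwich)
  show "(\<lambda>r. f a) \<longlonglongrightarrow> f a" by simp
  show "(\<lambda>r. f a + w r) \<longlonglongrightarrow> f a"
    using tendsto_add[OF tendsto_const summable_LIMSEQ_zero[OF summable_w]] by simp
qed (use approximant_bounds in auto)

text \<open>Points that agree up to \<open>k \<ge> r\<close> have equal approximants. If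
  \<open>k < r\<close>, every competitor in the cylinder of \<open>a\<close> still agrees with
  \<open>b\<close> up to \<open>k\<close>, so its value exceeds \<open>f b\<close> by at most
  \<open>w k\<close>.\<close>

lemma summable_potential_approximant: "summable_potential (approximant f r) w"
proof
  have *: "approximant f r a \<le> approximant f r b + w k" if "\<And>i. i \<le> k \<Longrightarrow> a i = b i" for a b k
  proof (cases "r \<le> k")
    case True
    then have "word a 0 r = word b 0 r" using that by (simp add: word_eq_iff)
    then show ?thesis using w_nonneg[of k] by (simp add: approximant_def)
  next
    case False
    show ?thesis unfolding approximant_def[of f r a]
    proof (rule cSUP_least)
      show "cylinder (word a 0 r) \<noteq> {}" by (metis empty_iff in_cylinder_word)
      fix c assume "c \<in> cylinder (word a 0 r)"
      then have "c i = b i" if "i \<le> k" for i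
        using that False \<open>\<And>i. i \<le> k \<Longrightarrow> a i = b i\<close> by (simp add: in_cylinder_word)
      then have "\<bar>f c - f b\<bar> \<le> w k" by (rule var_le)
      then show "f c \<le> approximant f r b + w k" using approximant_bounds(1)[of b r] by linarith
    qed
  qed
  show "\<bar>approximant f r a - approximant f r b\<bar> \<le> w n" if "\<And>i. i \<le> n \<Longrightarrow> a i = b i" for n a b
    using *[of n a b] *[of n b a] that by fastforce
qed (rule summable_w)

end

definition fiber :: "('a \<Rightarrow> 'b) \<Rightarrow> (nat \<Rightarrow> 'b) \<Rightarrow> nat \<Rightarrow> 'a set" where
  "fiber p b i = p -` {b i}"

lemma fiber_ne: "surj p \<Longrightarrow> fiber p b i \<noteq> {}"
  unfolding fiber_def by (metis empty_iff insertI1 surjD vimageI)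

lemma fib_word: "map (fiber p b) [0..<Suc n] = fib p (word b 0 n)"
  by (simp add: fib_def word_def fiber_def comp_def del: upt_Suc)

text \<open>Uniqueness enters here: a measure known only through its Gibbs bounds acquires explicit
  cylinder weights. It serves both the potential and its approximants.\<close>

lemma pushforward_eq_nu:
  fixes \<mu> :: "(nat \<Rightarrow> 'a::{finite,discrete_topology}) measure"
    and p :: "'a \<Rightarrow> 'b::{finite,discrete_topology}"
  assumes "gibbs_measure \<mu> f" "summable_potential f w" "surj p"
  shows "measure (pushforward p \<mu>) (cylinder bs) = summable_potential.nu f (fib p bs)"
proof -
  interpret summable_potential f w by fact
  have st: "stationary \<mu>" using assms(1) by (simp add: stationary_def gibbs_measure_def)
  obtain K where "\<And>x. measure \<mu> (cylinder x) \<le> K * rel_weight (rev (map (\<lambda>s. {s}) x))"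
    using gibbs_rel_weight[OF assms(1,2)] by blast
  then have "measure \<mu> (cylinder x) = nuw x" for x
    by (rule nuw_unique[OF stationary_word_weights_measure[OF st]])
  then show ?thesis
    by (simp add: measure_pushforward_cylinder[OF st] nu_eq_sum_nuw fib_ne[OF assms(3)])
qed

text \<open>By \<open>nu_Cons\<close> the quotient is \<open>qinf\<close> of a padded sequence. That
  sequence agrees with \<open>fiber p b\<close> up to \<open>n\<close>, and \<open>qinf\<close>
  forgets the rest.\<close>

lemma pushforward_ratio_tendsto:
  fixes \<mu> :: "(nat \<Rightarrow> 'a::{finite,discrete_topology}) measure"
    and p :: "'a \<Rightarrow> 'b::{finite,discrete_topology}"
  assumes "gibbs_measure \<mu> f" "summable_potential f w" "surj p"
  shows "(\<lambda>n. ln (measure (pushforward p \<mu>) (cylinder (word b 0 n))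
                / measure (pushforward p \<mu>) (cylinder (word b 1 n))))
     \<longlonglongrightarrow> ln (summable_potential.qinf f (fiber p b))"
proof -
  interpret summable_potential f w by fact
  note ne = fib_ne[OF assms(3)] fiber_ne[OF assms(3)]
  have "measure (pushforward p \<mu>) (cylinder (word b 0 n)) / measure (pushforward p \<mu>) (cylinder (word b 1 n))
      = qinf (pad (fib p (word b 0 n)))" for n
  proof -
    have "word b 0 n = b 0 # word b 1 n" by (simp add: word_def upt_conv_Cons del: upt_Suc)
    then have "fib p (word b 0 n) = (p -` {b 0}) # fib p (word b 1 n)" by (simp add: fib_def)
    then show ?thesis
      using nu_pos[OF ne(1), of "word b 1 n"] by (simp add: pushforward_eq_nu[OF assms] nu_Cons)
  qed
  moreover have "(\<lambda>n. qinf (pad (fib p (word b 0 n)))) \<longlonglongrightarrow> qinf (fiber p b)"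
  proof (rule tendsto_of_ratio_bounds[OF qinf_pos[OF ne(2)]])
    fix \<eta> :: real assume "\<eta> > 0"
    then obtain m r where \<rho>: "(1 + rate m r)\<^sup>2 \<le> 1 + \<eta>" using rate_small by blast
    have "1 + rate m r \<le> (1 + rate m r)\<^sup>2" using rate_nonneg[of m r] by (simp add: power2_eq_square algebra_simps)
    with \<rho> have \<rho>: "1 + rate m r \<le> 1 + \<eta>" by linarith
    have eq: "pad (fib p (word b 0 n)) i = fiber p b i" if "i \<le> n" for i n
      using that by (simp add: pad_def fib_def word_def fiber_def nth_append del: upt_Suc)
    show "\<forall>\<^sub>F n in sequentially. qinf (pad (fib p (word b 0 n))) \<le> (1 + \<eta>) * qinf (fiber p b) \<and>
      qinf (fiber p b) \<le> (1 + \<eta>) * qinf (pad (fib p (word b 0 n)))"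
      using eventually_ge_at_top[of "m * r"]
    proof eventually_elim
      case (elim n)
      have "qinf (pad (fib p (word b 0 n))) \<le> (1 + rate m r) * qinf (fiber p b)"
        by (rule qinf_compare[OF pad_ne[OF ne(1)] ne(2) _ elim]) (rule eq)
      moreover have "qinf (fiber p b) \<le> (1 + rate m r) * qinf (pad (fib p (word b 0 n)))"
        by (rule qinf_compare[OF ne(2) pad_ne[OF ne(1)] _ elim]) (rule eq[symmetric])
      moreover have "0 < qinf (fiber p b)" "0 < qinf (pad (fib p (word b 0 n)))"
        by (intro qinf_pos ne pad_ne)+
      ultimately show ?case using \<rho> by (meson less_imp_le mult_right_mono order_trans)
    qed
  qed
  ultimately show ?thesis
    using qinf_pos[of "fiber p b"] ne(2) by (auto intro!: tendsto_ln)
qed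

section \<open>The potential and its Birkhoff sums\<close>

context summable_potential
begin

definition phi :: "('a \<Rightarrow> 'b) \<Rightarrow> (nat \<Rightarrow> 'b) \<Rightarrow> real" where
  "phi p b = ln (qinf (fiber p b))"

lemma phi_var:
  assumes "surj p" "m * r \<le> n" "\<And>i. i \<le> n \<Longrightarrow> b i = b' i"
  shows "\<bar>phi p b - phi p b'\<bar> \<le> rate m r"
proof -
  note ne = fiber_ne[OF assms(1)]
  have *: "phi p b - phi p b' \<le> rate m r" if "\<And>i. i \<le> n \<Longrightarrow> b i = b' i" for b b'
  proof -
    have pos: "0 < qinf (fiber p b)" "0 < qinf (fiber p b')" by (intro qinf_pos ne)+
    have "qinf (fiber p b) \<le> (1 + rate m r) * qinf (fiber p b')"
      by (rule qinf_compare[OF ne ne _ assms(2)]) (simp add: fiber_def that)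
    then have "phi p b \<le> ln ((1 + rate m r) * qinf (fiber p b'))"
      unfolding phi_def using pos rate_nonneg[of m r] by (subst ln_le_cancel_iff) (auto intro!: mult_pos_pos)
    also have "\<dots> = ln (1 + rate m r) + phi p b'"
      unfolding phi_def using pos rate_nonneg[of m r] by (subst ln_mult) auto
    finally show ?thesis using ln_add_one_self_le_self[OF rate_nonneg[of m r]] by simp
  qed
  show ?thesis using *[of b b'] *[of b' b] assms(3) by fastforce
qed

lemma exp_birkhoff_phi:
  assumes "surj p"
  shows "exp (birkhoff_sum n (phi p) b) = prodq (fiber p b) n"
proof -
  have "exp (phi p ((shift ^^ j) b)) = qinf (\<lambda>i. fiber p b (i + j))" for j
  proof -
    have "fiber p ((shift ^^ j) b) = (\<lambda>i. fiber p b (i + j))"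
      by (rule ext) (simp add: fiber_def funpow_shift)
    then show ?thesis using qinf_pos[of "fiber p ((shift ^^ j) b)"] fiber_ne[OF assms] by (simp add: phi_def)
  qed
  then show ?thesis by (simp add: birkhoff_sum_def prodq_def exp_sum)
qed

text \<open>The Birkhoff sum keeps the fibres of all of \<open>b\<close>, whereas \<open>nu\<close>
  frees the positions beyond \<open>n\<close>. Both are within \<open>exp (4 * tail 0)\<close> of
  the relative weight of the first \<open>n + 1\<close> fibres.\<close>

lemma nu_phi:
  assumes "surj p"
  shows "nu (fib p (word b 0 n)) \<le> exp (8 * tail 0) * exp (birkhoff_sum (Suc n) (phi p) b)"
    and "exp (birkhoff_sum (Suc n) (phi p) b) \<le> exp (8 * tail 0) * nu (fib p (word b 0 n))"
proof -
  have E: "exp (8 * tail 0) = exp (4 * tail 0) * exp (4 * tail 0)" by (simp flip: exp_add)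
  have seg: "seg (fiber p b) 0 (Suc n) = rev (fib p (word b 0 n))"
    unfolding seg_def fib_word ..
  note a = nu_rel_weight[OF fib_ne[OF assms], of "word b 0 n"]
  note b = prodq_rel_weight[of "fiber p b" "Suc n", OF fiber_ne[OF assms], unfolded seg]
  show "nu (fib p (word b 0 n)) \<le> exp (8 * tail 0) * exp (birkhoff_sum (Suc n) (phi p) b)"
    unfolding exp_birkhoff_phi[OF assms] E 
    by (rule order_trans[OF a(1)]) (use b(2) in \<open>simp add: mult.assoc\<close>)
  show "exp (birkhoff_sum (Suc n) (phi p) b) \<le> exp (8 * tail 0) * nu (fib p (word b 0 n))"
    unfolding exp_birkhoff_phi[OF assms] E 
    by (rule order_trans[OF b(1)]) (use a(2) in \<open>simp add: mult.assoc\<close>)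
qed

end

section \<open>Gibbs property, support and pressure\<close>

lemma continuous_on_cylinder_var:
  fixes \<phi> :: "(nat \<Rightarrow> 'b::discrete_topology) \<Rightarrow> real"
  assumes "\<And>e. e > 0 \<Longrightarrow> \<exists>n. \<forall>a b. (\<forall>i\<le>n. a i = b i) \<longrightarrow> \<bar>\<phi> a - \<phi> b\<bar> < e"
  shows "continuous_on UNIV \<phi>"
  unfolding continuous_on_topological
proof (intro ballI allI impI)
  fix a B assume "open B" "\<phi> a \<in> B"
  then obtain e where e: "e > 0" "\<And>y. \<bar>\<phi> a - y\<bar> < e \<Longrightarrow> y \<in> B"
    by (auto simp: open_dist dist_real_def abs_minus_commute)
  obtain n where n: "\<And>b. (\<forall>i\<le>n. a i = b i) \<Longrightarrow> \<bar>\<phi> a - \<phi> b\<bar> < e"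
    using assms[OF e(1)] by blast
  show "\<exists>A. open A \<and> a \<in> A \<and> (\<forall>y\<in>UNIV. y \<in> A \<longrightarrow> \<phi> y \<in> B)"
    by (intro exI[of _ "cylinder (word a 0 n)"] conjI ballI impI e n open_cylinder)
      (simp_all add: in_cylinder_word)
qed

text \<open>The bounds with \<open>P = 0\<close> are stated separately because
  \<open>gibbs_measure\<close> hides \<open>P\<close> behind a quantifier, while the pressure is
  computed from this value.\<close>

lemma gibbs_pushforward:
  fixes \<mu> :: "(nat \<Rightarrow> 'a::{finite,discrete_topology}) measure"
    and p :: "'a \<Rightarrow> 'b::{finite,discrete_topology}"
  assumes "gibbs_measure \<mu> f" "summable_potential f w" "surj p"
  shows "\<exists>C. C \<ge> 1 \<and> (\<forall>n b.
      inverse C \<le> measure (pushforward p \<mu>) (cylinder (word b 0 n))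
          / exp (birkhoff_sum (n + 1) (summable_potential.phi f p) b) \<and>
      measure (pushforward p \<mu>) (cylinder (word b 0 n))
          / exp (birkhoff_sum (n + 1) (summable_potential.phi f p) b) \<le> C)"
    and "gibbs_measure (pushforward p \<mu>) (summable_potential.phi f p)"
proof -
  interpret summable_potential f w by fact
  have "1 \<le> exp (8 * tail 0)" using tail_nonneg[of 0] by simp
  moreover have "inverse (exp (8 * tail 0)) \<le> measure (pushforward p \<mu>) (cylinder (word b 0 n)) / exp (birkhoff_sum (n + 1) (phi p) b)
     \<and> measure (pushforward p \<mu>) (cylinder (word b 0 n)) / exp (birkhoff_sum (n + 1) (phi p) b) \<le> exp (8 * tail 0)" for n b
    unfolding pushforward_eq_nu[OF assms] using nu_phi[OF assms(3), where b = b and n = n] by (simp add: field_simps)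
  ultimately show ex: "\<exists>C. C \<ge> 1 \<and> (\<forall>n b.
      inverse C \<le> measure (pushforward p \<mu>) (cylinder (word b 0 n)) / exp (birkhoff_sum (n + 1) (phi p) b) \<and>
      measure (pushforward p \<mu>) (cylinder (word b 0 n)) / exp (birkhoff_sum (n + 1) (phi p) b) \<le> C)"
    by blast
  have cont: "continuous_on UNIV (phi p)"
  proof (rule continuous_on_cylinder_var)
    fix e :: real assume "e > 0"
    then obtain m r where \<rho>: "(1 + rate m r)\<^sup>2 \<le> 1 + e / 2" using rate_small[of "e / 2"] by auto
    have "1 + rate m r \<le> (1 + rate m r)\<^sup>2" using rate_nonneg[of m r] by (simp add: power2_eq_square algebra_simps)
    with \<rho> \<open>e > 0\<close> have "rate m r < e" by linarith
    then show "\<exists>n. \<forall>a b. (\<forall>i\<le>n. a i = b i) \<longrightarrow> \<bar>phi p a - phi p b\<bar> < e"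
      using phi_var[OF assms(3), of m r "m * r"] by (intro exI[of _ "m * r"]) (meson le_less_trans order_refl)
  qed
  have "stationary (pushforward p \<mu>)"
    using assms(1) by (intro stationary_pushforward) (simp add: stationary_def gibbs_measure_def)
  moreover obtain C where "C \<ge> 1" "\<forall>n b.
      inverse C \<le> measure (pushforward p \<mu>) (cylinder (word b 0 n)) / exp (birkhoff_sum (n + 1) (phi p) b - real (n + 1) * 0) \<and>
      measure (pushforward p \<mu>) (cylinder (word b 0 n)) / exp (birkhoff_sum (n + 1) (phi p) b - real (n + 1) * 0) \<le> C"
    using ex by auto
  ultimately show "gibbs_measure (pushforward p \<mu>) (phi p)"
    using cont unfolding gibbs_measure_def stationary_def by blast
qed

lemma measure_support_UNIV:
  fixes m :: "(nat \<Rightarrow> 'b::{finite,discrete_topology}) measure"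
  assumes "stationary m" "\<And>b n. 0 < measure m (cylinder (word b 0 n))"
  shows "measure_support m = UNIV"
proof -
  have sets: "sets m = sets borel" and "prob_space m" using assms(1) by (auto simp: stationary_def)
  interpret prob_space m by fact
  have "0 < emeasure m U" if U: "open U" "b \<in> U" for b U
  proof -
    obtain n where n: "cylinder (word b 0 n) \<subseteq> U" using cylinder_in_open[OF U] .
    have "0 < emeasure m (cylinder (word b 0 n))" using assms(2)[of b n] by (simp add: emeasure_eq_measure)
    also have "\<dots> \<le> emeasure m U" using n U by (intro emeasure_mono) (auto simp: sets)
    finally show ?thesis .
  qed
  then show ?thesis by (auto simp: measure_support_def)
qed

lemma bij_betw_periodic_words:
  assumes "n > 0"
  shows "bij_betw (\<lambda>a. word a 0 (n - 1)) {a :: nat \<Rightarrow> 'b::finite. (shift ^^ n) a = a} (words n)"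
proof (rule bij_betw_byWitness[where f' = "\<lambda>x i. x ! (i mod n)"])
  have word: "word a 0 (n - 1) = map a [0..<n]" for a :: "nat \<Rightarrow> 'b" using assms by (simp add: word_def)
  show "\<forall>a\<in>{a :: nat \<Rightarrow> 'b. (shift ^^ n) a = a}. (\<lambda>i. word a 0 (n - 1) ! (i mod n)) = a"
  proof (intro ballI ext)
    fix a :: "nat \<Rightarrow> 'b" and i assume "a \<in> {a. (shift ^^ n) a = a}"
    then have "(shift ^^ n) a = a" by simp
    then have per: "a (j + n) = a j" for j using fun_cong[of "(shift ^^ n) a" a j] unfolding funpow_shift by blast
    have "a (j + k * n) = a j" for j k
    proof (induction k)
      case (Suc k)
      then show ?case using per[of "j + k * n"] by (simp add: algebra_simps)
    qed simp
    from this[of "i mod n" "i div n"] show "word a 0 (n - 1) ! (i mod n) = a i"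
      unfolding word using assms by simp
  qed
  show "\<forall>x\<in>words n. word (\<lambda>i. x ! (i mod n)) 0 (n - 1) = (x :: 'b list)"
    unfolding word by (auto simp: words_eq intro: nth_equalityI)
  show "(\<lambda>a. word a 0 (n - 1)) ` {a :: nat \<Rightarrow> 'b. (shift ^^ n) a = a} \<subseteq> words n"
    unfolding word by (auto simp: words_eq)
  show "(\<lambda>x i. x ! (i mod n)) ` words n \<subseteq> {a :: nat \<Rightarrow> 'b. (shift ^^ n) a = a}"
    by (auto simp: funpow_shift)
qed

text \<open>Points of period \<open>n\<close> correspond to words of length \<open>n\<close>, whose
  cylinders have total measure 1. The periodic sums therefore stay between \<open>inverse C\<close>
  and \<open>C\<close>.\<close>

lemma pressure_eq_0:
  fixes m :: "(nat \<Rightarrow> 'b::{finite,discrete_topology}) measure"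
  assumes "stationary m" "C \<ge> 1"
    and lo: "\<And>n b. inverse C \<le> measure m (cylinder (word b 0 n)) / exp (birkhoff_sum (n + 1) \<phi> b)"
    and up: "\<And>n b. measure m (cylinder (word b 0 n)) / exp (birkhoff_sum (n + 1) \<phi> b) \<le> C"
  shows "pressure \<phi> = 0"
proof -
  interpret stationary_word_weights "\<lambda>x. measure m (cylinder x)"
    using assms(1) by (rule stationary_word_weights_measure)
  define Z where "Z n = (\<Sum>a | (shift ^^ n) a = a. exp (birkhoff_sum n \<phi> a))" for n
  have Z: "inverse C \<le> Z n" "Z n \<le> C" if "n > 0" for n
  proof -
    have s: "(\<Sum>a | (shift ^^ n) a = a. measure m (cylinder (word a 0 (n - 1)))) = 1"
      using sum.reindex_bij_betw[OF bij_betw_periodic_words[OF that], of "\<lambda>x. measure m (cylinder x)"] sum_words by simp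
    have b: "measure m (cylinder (word a 0 (n - 1))) \<le> C * exp (birkhoff_sum n \<phi> a)"
       "exp (birkhoff_sum n \<phi> a) \<le> C * measure m (cylinder (word a 0 (n - 1)))" for a
      using lo[where n = "n - 1" and b = a] up[where n = "n - 1" and b = a] that \<open>C \<ge> 1\<close> by (simp_all add: field_simps)
    have "1 \<le> C * Z n" unfolding s[symmetric] Z_def sum_distrib_left by (intro sum_mono b)
    then show "inverse C \<le> Z n" using \<open>C \<ge> 1\<close> by (simp add: field_simps)
    have "Z n \<le> C * 1" unfolding s[symmetric] Z_def sum_distrib_left by (intro sum_mono b)
    then show "Z n \<le> C" by simp
  qed
  have "(\<lambda>n. 1 / real n * ln (Z n)) \<longlonglongrightarrow> 0"
  proof (rule Lim_null_comparison)
    show "(\<lambda>n. ln C / real n) \<longlonglongrightarrow> 0" by (rule lim_const_over_n)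
    show "\<forall>\<^sub>F n in sequentially. norm (1 / real n * ln (Z n)) \<le> ln C / real n"
      using eventually_gt_at_top[of 0]
    proof eventually_elim
      case (elim n)
      have pos: "0 < Z n" using Z(1)[OF elim] \<open>C \<ge> 1\<close> by (smt (verit) inverse_positive_iff_positive)
      have "ln (Z n) \<le> ln C" using Z[OF elim] pos \<open>C \<ge> 1\<close> by simp
      moreover have "ln (inverse C) \<le> ln (Z n)" using Z[OF elim] pos \<open>C \<ge> 1\<close> by (subst ln_le_cancel_iff) auto
      then have "- ln C \<le> ln (Z n)" using \<open>C \<ge> 1\<close> by (simp add: ln_inverse)
      ultimately have "\<bar>ln (Z n)\<bar> \<le> ln C" by linarith
      then show ?case using elim by (simp add: abs_mult divide_right_mono)
    qed
  qed
  then have "(\<lambda>n. ereal (1 / real n * ln (Z n))) \<longlonglongrightarrow> ereal 0" by (rule tendsto_ereal)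
  from lim_imp_Limsup[OF sequentially_bot this] show ?thesis
    unfolding pressure_def Z_def[symmetric] zero_ereal_def .
qed

text \<open>The weight \<open>s ^ 2\<close> vanishes at \<open>s = 0\<close>, so the summability
  hypothesis does not control this variation. The Gibbs bounds do: points with the same first letter
  share a cylinder of length one, whence
  \<open>exp (\<psi> a - \<psi> b) \<le> C * C\<close>.\<close>

lemma variation_finite_0:
  assumes "gibbs_measure \<mu> \<psi>"
  shows "variation \<psi> 0 < \<infinity>"
proof -
  have "\<exists>C P :: real. C \<ge> 1 \<and> (\<forall>n a.
        inverse C \<le> measure \<mu> (cylinder (word a 0 n)) / exp (birkhoff_sum (n + 1) \<psi> a - real (n + 1) * P) \<and>
        measure \<mu> (cylinder (word a 0 n)) / exp (birkhoff_sum (n + 1) \<psi> a - real (n + 1) * P) \<le> C)"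
    using assms unfolding gibbs_measure_def by (elim conjE)
  then obtain C P where C: "C \<ge> 1" and
    gibbs: "\<And>n a. inverse C \<le> measure \<mu> (cylinder (word a 0 n)) / exp (birkhoff_sum (n + 1) \<psi> a - real (n + 1) * P)"
      "\<And>n a. measure \<mu> (cylinder (word a 0 n)) / exp (birkhoff_sum (n + 1) \<psi> a - real (n + 1) * P) \<le> C"
    by auto
  have le: "\<psi> a - \<psi> b \<le> ln (C * C)" if "word a 0 0 = word b 0 0" for a b
  proof -
    let ?m = "measure \<mu> (cylinder (word b 0 0))"
    have "exp (\<psi> a - P) \<le> C * ?m" "?m \<le> C * exp (\<psi> b - P)"
      using gibbs(1)[where n = 0 and a = a] gibbs(2)[where n = 0 and a = b] C that by (auto simp: field_simps birkhoff_sum_def)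
    then have "exp (\<psi> a - P) \<le> C * (C * exp (\<psi> b - P))"
      using C mult_left_mono[of ?m "C * exp (\<psi> b - P)" C] by linarith
    then have "exp (\<psi> a - \<psi> b) \<le> C * C" by (simp add: exp_diff field_simps)
    then show ?thesis using C by (subst ln_ge_iff) auto
  qed
  have "variation \<psi> 0 \<le> ennreal (ln (C * C))"
    unfolding variation_def
  proof (rule SUP_least, clarify)
    fix a b :: "nat \<Rightarrow> 'a" assume "word a 0 0 = word b 0 0"
    then show "ennreal \<bar>\<psi> a - \<psi> b\<bar> \<le> ennreal (ln (C * C))"
      using le[of a b] le[of b a] by (intro ennreal_leI) simp
  qed
  then show ?thesis by (simp add: le_less_trans)
qed

lemma summable_potential_variation:
  fixes \<psi> :: "(nat \<Rightarrow> 'a::{finite,discrete_topology}) \<Rightarrow> real"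
  assumes fin: "(\<Sum>s. of_nat (s ^ 2) * variation \<psi> s) < \<infinity>" and "gibbs_measure \<mu> \<psi>"
  shows "summable_potential \<psi> (\<lambda>n. enn2real (variation \<psi> n))"
    and "variation \<psi> n < \<infinity>"
proof -
  have le: "variation \<psi> n \<le> of_nat (n ^ 2) * variation \<psi> n" if "n > 0" for n
  proof -
    have "of_nat 1 * variation \<psi> n \<le> of_nat (n ^ 2) * variation \<psi> n"
      using that by (intro mult_right_mono of_nat_mono) (simp_all add: Suc_leI)
    then show ?thesis by simp
  qed
  have "of_nat (n ^ 2) * variation \<psi> n \<le> (\<Sum>s. of_nat (s ^ 2) * variation \<psi> s)" for n
    using sum_le_suminf[of "\<lambda>s. of_nat (s ^ 2) * variation \<psi> s" "{n}"] by simp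
  then show *: "variation \<psi> n < \<infinity>" for n
    using variation_finite_0[OF assms(2)] le[of n] fin by (cases "n = 0") (auto intro: le_less_trans)
  let ?w = "\<lambda>n. enn2real (variation \<psi> n)"
  have w: "variation \<psi> n = ennreal (?w n)" for n using *[of n] by simp
  show "summable_potential \<psi> ?w"
  proof
    fix n and a b :: "nat \<Rightarrow> 'a" assume "\<And>i. i \<le> n \<Longrightarrow> a i = b i"
    then have "word a 0 n = word b 0 n" by (simp add: word_eq_iff)
    then have "ennreal \<bar>\<psi> a - \<psi> b\<bar> \<le> variation \<psi> n"
      unfolding variation_def by (intro SUP_upper2[of "(a, b)"]) auto
    then show "\<bar>\<psi> a - \<psi> b\<bar> \<le> ?w n" by (subst (asm) w) simp
  next
    have "ennreal (real (s ^ 2) * ?w s) = of_nat (s ^ 2) * variation \<psi> s" for s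
      by (subst ennreal_mult) (simp_all only: w[symmetric] ennreal_of_nat_eq_real_of_nat of_nat_0_le_iff enn2real_nonneg)
    then have "summable (\<lambda>s. real (s ^ 2) * ?w s)"
      using fin by (intro summable_suminf_not_top) auto
    then show "summable ?w"
    proof (rule summable_comparison_test_ev[rotated])
      show "\<forall>\<^sub>F n in sequentially. norm (?w n) \<le> real (n ^ 2) * ?w n"
        using eventually_gt_at_top[of 0]
      proof eventually_elim
        case (elim n)
        then have "1 * ?w n \<le> real (n ^ 2) * ?w n"
          by (intro mult_right_mono) (simp_all add: Suc_leI)
        then show ?case by simp
      qed
    qed
  qed
qed

section \<open>Decay of variations\<close>

lemma stretched_exp_le_powr:
  fixes \<kappa> a s :: real
  assumes "\<kappa> > 0" "a > 0"
  obtains K where "K > 0" "\<And>n :: nat. n \<ge> 1 \<Longrightarrow> exp (- \<kappa> * real n powr a) \<le> K * real n powr (- s)"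
proof -
  have "(\<lambda>n :: nat. exp (- \<kappa> * real n powr a) * real n powr s) \<longlonglongrightarrow> 0"
    using assms by real_asymp
  then have "Bseq (\<lambda>n :: nat. exp (- \<kappa> * real n powr a) * real n powr s)"
    by (intro convergent_imp_Bseq convergentI)
  then obtain K where K: "K > 0" "\<And>n :: nat. norm (exp (- \<kappa> * real n powr a) * real n powr s) \<le> K"
    by (auto simp: Bseq_def)
  have "exp (- \<kappa> * real n powr a) \<le> K * real n powr (- s)" if "n \<ge> 1" for n :: nat
  proof -
    have "0 < real n powr s" using that by simp
    then show ?thesis using K(2)[of n] by (simp add: powr_minus field_simps)
  qed
  with K(1) that show thesis by blast
qed

text \<open>The case \<open>y = 0\<close> covers \<open>n = 0\<close>, where the powers of
  \<open>real n\<close> vanish.\<close>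

lemma floor_half_le:
  fixes y :: real
  assumes "y = 0 \<or> y \<ge> 1"
  shows "y / 2 \<le> real (nat \<lfloor>y\<rfloor>)"
proof (cases "y = 0")
  case False
  then have "1 \<le> \<lfloor>y\<rfloor>" using assms by simp
  then have "real (nat \<lfloor>y\<rfloor>) = of_int \<lfloor>y\<rfloor>" "1 \<le> real_of_int \<lfloor>y\<rfloor>" by auto
  then show ?thesis by linarith
qed simp

lemma floor_mult_le:
  fixes n :: nat
  assumes "a + b = 1"
  shows "nat \<lfloor>real n powr a\<rfloor> * nat \<lfloor>real n powr b\<rfloor> \<le> n"
proof -
  have "real (nat \<lfloor>real n powr a\<rfloor> * nat \<lfloor>real n powr b\<rfloor>) \<le> real n powr a * real n powr b"
    unfolding of_nat_mult by (intro mult_mono) auto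
  also have "\<dots> = real n" using assms by (cases "n = 0") (auto simp flip: powr_add)
  finally show ?thesis by linarith
qed

context summable_potential
begin

lemma rate_le:
  "rate m r \<le> exp (2 * tail 0) * (exp (- exp (- 2 * tail 0) * real m) + 2 * tail r)"
proof -
  let ?\<kappa> = "exp (- 2 * tail 0)"
  have "(1 - ?\<kappa>) ^ m \<le> exp (- ?\<kappa>) ^ m"
    using exp_ge_add_one_self[of "- ?\<kappa>"] tail_nonneg[of 0] by (intro power_mono) auto
  also have "\<dots> = exp (- ?\<kappa> * real m)" by (simp flip: exp_of_nat2_mult)
  finally have "(1 - ?\<kappa>) ^ m * (exp (2 * tail 0) - 1) \<le> exp (- ?\<kappa> * real m) * exp (2 * tail 0)"
    using tail_nonneg[of 0] by (intro mult_mono) auto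
  moreover have "exp (2 * tail r) - 1 \<le> exp (2 * tail 0) * (2 * tail r)"
  proof -
    have "1 - exp (- (2 * tail r)) \<le> 2 * tail r" using exp_ge_add_one_self[of "- (2 * tail r)"] by linarith
    then have "exp (2 * tail r) * (1 - exp (- (2 * tail r))) \<le> exp (2 * tail r) * (2 * tail r)"
      by (rule mult_left_mono) simp
    also have "\<dots> \<le> exp (2 * tail 0) * (2 * tail r)"
      using tail_nonneg[of r] tail_le_0[of r] by (intro mult_right_mono) auto
    finally show ?thesis by (simp add: right_diff_distrib mult_exp_exp)
  qed
  ultimately show ?thesis unfolding rate_def by (simp add: algebra_simps)
qed

lemma tail_bound:
  assumes "\<And>i. w (i + r) \<le> c * u i" "summable u"
  shows "tail r \<le> c * suminf u"
proof -
  have "tail r \<le> (\<Sum>i. c * u i)"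
    unfolding tail_def using assms summable_w by (intro suminf_le summable_mult) (auto simp: summable_iff_shift)
  then show ?thesis using suminf_mult[OF assms(2)] by simp
qed

lemma variation_phi:
  assumes "surj p" "m * r \<le> n" "exp (2 * tail 0) * (exp (- exp (- 2 * tail 0) * real m) + 2 * tail r) \<le> X"
  shows "variation (phi p) n \<le> ennreal X"
  unfolding variation_def
proof (rule SUP_least, clarify)
  fix b b' :: "nat \<Rightarrow> 'b" assume "word b 0 n = word b' 0 n"
  then have "\<bar>phi p b - phi p b'\<bar> \<le> rate m r" using assms(1,2) by (intro phi_var) (auto simp: word_eq_iff)
  with rate_le[of m r] assms(3) show "ennreal \<bar>phi p b - phi p b'\<bar> \<le> ennreal X"
    by (intro ennreal_leI) linarith
qed

text \<open>Blocks of length \<open>n powr (1 / (1 + \<gamma>))\<close> balance the contraction with the tail.\<close>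

lemma variation_phi_stretched:
  assumes "surj p" "C > 0" "c > 0" "0 < \<gamma>" "\<gamma> < 1"
    and w: "\<And>n. w n \<le> C * exp (- c * real n powr \<gamma>)"
  shows "\<exists>D d. D > C \<and> 0 < d \<and> d < c \<and>
    (\<forall>n. variation (phi p) n \<le> ennreal (D * exp (- d * real n powr (\<gamma> / (1 + \<gamma>)))))"
proof -
  let ?A = "exp (2 * tail 0)"
  define \<kappa> where "\<kappa> = exp (- 2 * tail 0)"
  have "\<kappa> > 0" by (simp add: \<kappa>_def)
  \<comment> \<open>Half of the exponent is spent on summability in \<open>i\<close>; the other half
    survives as decay in \<open>r\<close>.\<close>
  define u where "u i = exp (- (c / 2) * real i powr \<gamma>)" for i :: nat
  obtain K where K: "\<And>n :: nat. n \<ge> 1 \<Longrightarrow> u n \<le> K * real n powr (- 2)"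
    using stretched_exp_le_powr[of "c / 2" \<gamma> 2] assms unfolding u_def by (metis half_gt_zero)
  have "summable u"
  proof (rule summable_comparison_test_ev)
    show "summable (\<lambda>n. K * real n powr (- 2))"
      by (intro summable_mult) (simp add: summable_real_powr_iff)
    show "\<forall>\<^sub>F n in sequentially. norm (u n) \<le> K * real n powr (- 2)"
      using eventually_ge_at_top[of 1] by eventually_elim (use K in \<open>auto simp: u_def\<close>)
  qed
  define B where "B = C * suminf u"
  have "B \<ge> 0" unfolding B_def using assms(2) \<open>summable u\<close>
    by (intro mult_nonneg_nonneg suminf_nonneg) (auto simp: u_def)
  have tail: "tail r \<le> B * exp (- (c / 2) * real r powr \<gamma>)" for r
  proof -
    have "tail r \<le> (C * exp (- (c / 2) * real r powr \<gamma>)) * suminf u"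
    proof (rule tail_bound[OF _ \<open>summable u\<close>])
      fix i
      have "real i powr \<gamma> \<le> real (i + r) powr \<gamma>" "real r powr \<gamma> \<le> real (i + r) powr \<gamma>"
        using assms(4) by (intro powr_mono2; simp)+
      then have "c * real r powr \<gamma> + c * real i powr \<gamma> \<le> c * (2 * real (i + r) powr \<gamma>)"
        using assms(3) by (simp flip: distrib_left)
      then have "exp (- c * real (i + r) powr \<gamma>) \<le> exp (- (c / 2) * real r powr \<gamma>) * u i"
        unfolding u_def mult_exp_exp by simp
      then have "C * exp (- c * real (i + r) powr \<gamma>) \<le> C * (exp (- (c / 2) * real r powr \<gamma>) * u i)"
        using assms(2) by (intro mult_left_mono) auto
      then show "w (i + r) \<le> C * exp (- (c / 2) * real r powr \<gamma>) * u i"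
        using w[of "i + r"] by (simp add: mult.assoc)
    qed
    then show ?thesis by (simp add: B_def mult_ac)
  qed
  \<comment> \<open>\<open>\<kappa>\<close> is the contraction per block. \<open>c / 4\<close> is
    the rate \<open>c / 2\<close> of the tail, halved again because rounding \<open>y\<close> down
    costs the factor \<open>(1 / 2) powr \<gamma> \<ge> 1 / 2\<close>.\<close>
  define d where "d = min \<kappa> (c / 4)"
  have d: "0 < d" "d < c" "d \<le> \<kappa>" "d \<le> c / 4" using assms(3) \<open>\<kappa> > 0\<close> by (auto simp: d_def)
  \<comment> \<open>\<open>C + 1\<close> forces \<open>D > C\<close>, and
    \<open>exp \<kappa>\<close> pays for rounding \<open>x\<close> down to \<open>m\<close>.\<close>
  define D where "D = max (C + 1) (?A * (exp \<kappa> + 2 * B))"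
  have "variation (phi p) n \<le> ennreal (D * exp (- d * real n powr (\<gamma> / (1 + \<gamma>))))" for n
  proof -
    define x where "x = real n powr (\<gamma> / (1 + \<gamma>))"
    define y where "y = real n powr (1 / (1 + \<gamma>))"
    define m where "m = nat \<lfloor>x\<rfloor>"
    define r where "r = nat \<lfloor>y\<rfloor>"
    have "\<gamma> / (1 + \<gamma>) + 1 / (1 + \<gamma>) = 1" using assms(4) by (simp add: field_simps)
    then have mr: "m * r \<le> n" unfolding m_def r_def x_def y_def by (rule floor_mult_le)
    have x: "0 \<le> x" "x - 1 \<le> real m" by (auto simp: x_def m_def)
    have "y = 0 \<or> y \<ge> 1"
      using assms(4) by (cases "n = 0") (auto simp: y_def intro!: ge_one_powr_ge_zero)
    then have y: "y / 2 \<le> real r" unfolding r_def by (rule floor_half_le)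
    have "x / 2 \<le> (1 / 2) powr \<gamma> * x"
    proof -
      have "(1 / 2 :: real) powr 1 \<le> (1 / 2) powr \<gamma>" using assms(5) by (intro powr_mono') auto
      then show ?thesis using x(1) mult_right_mono[of "1 / 2" "(1 / 2) powr \<gamma>" x] by simp
    qed
    also have "(1 / 2) powr \<gamma> * x = (y / 2) powr \<gamma>"
      unfolding x_def y_def by (simp add: powr_mult powr_divide powr_powr)
    also have "\<dots> \<le> real r powr \<gamma>" using y assms(4) by (intro powr_mono2) (auto simp: y_def)
    finally have r: "x / 2 \<le> real r powr \<gamma>" .
    have "exp (- \<kappa> * real m) \<le> exp \<kappa> * exp (- d * x)"
    proof -
      have "\<kappa> * (x - 1) \<le> \<kappa> * real m" using x(2) \<open>\<kappa> > 0\<close> by (intro mult_left_mono) auto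
      moreover have "d * x \<le> \<kappa> * x" using d x by (intro mult_right_mono) auto
      ultimately show ?thesis unfolding mult_exp_exp by (simp add: algebra_simps)
    qed
    moreover have "tail r \<le> B * exp (- d * x)"
    proof -
      have "d * x \<le> (c / 4) * x" using d x by (intro mult_right_mono) auto
      also have "\<dots> = (c / 2) * (x / 2)" by simp
      also have "\<dots> \<le> (c / 2) * real r powr \<gamma>" using r assms(3) by (intro mult_left_mono) auto
      finally have "exp (- (c / 2) * real r powr \<gamma>) \<le> exp (- d * x)" by simp
      then have "B * exp (- (c / 2) * real r powr \<gamma>) \<le> B * exp (- d * x)" using \<open>B \<ge> 0\<close> by (rule mult_left_mono)
      then show ?thesis using tail[of r] by linarith
    qed
    ultimately have "exp (- \<kappa> * real m) + 2 * tail r \<le> (exp \<kappa> + 2 * B) * exp (- d * x)"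
      unfolding distrib_right mult.assoc by linarith
    then have "?A * (exp (- \<kappa> * real m) + 2 * tail r) \<le> ?A * ((exp \<kappa> + 2 * B) * exp (- d * x))"
      by (intro mult_left_mono) auto
    also have "\<dots> = (?A * (exp \<kappa> + 2 * B)) * exp (- d * x)" by simp
    also have "\<dots> \<le> D * exp (- d * x)" unfolding D_def by (intro mult_right_mono) auto
    finally show ?thesis
      using assms(1) mr unfolding \<kappa>_def x_def by (intro variation_phi)
  qed
  moreover have "D > C" by (simp add: D_def)
  ultimately show ?thesis using d by blast
qed

lemma variation_phi_polynomial:
  assumes "surj p" "C > 0" "q > 3" "0 < \<epsilon>" "\<epsilon> < q - 3"
    and w: "\<And>n. n \<ge> 1 \<Longrightarrow> w n \<le> C * real n powr (- q)"
  shows "\<exists>D>C. \<forall>n\<ge>1. variation (phi p) n \<le> ennreal (D * (1 / real n powr (q - 2 - \<epsilon>)))"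
proof -
  let ?A = "exp (2 * tail 0)"
  define \<kappa> where "\<kappa> = exp (- 2 * tail 0)"
  have "\<kappa> > 0" by (simp add: \<kappa>_def)
  \<comment> \<open>Two of the \<open>q\<close> powers are spent on summability in \<open>i\<close>,
    which leaves \<open>q - 2\<close> for the tail.\<close>
  define u where "u i = inverse (real (Suc i) ^ 2)" for i :: nat
  have "summable u"
    unfolding u_def using inverse_power_summable[of 2, where 'a = real] by (subst summable_Suc_iff) simp
  define B where "B = C * suminf u"
  have "B \<ge> 0" unfolding B_def using assms(2) \<open>summable u\<close>
    by (intro mult_nonneg_nonneg suminf_nonneg) (auto simp: u_def)
  have tail: "tail r \<le> B * real r powr (- (q - 2))" if "r \<ge> 1" for r
  proof -
    have "tail r \<le> (C * real r powr (- (q - 2))) * suminf u"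
    proof (rule tail_bound[OF _ \<open>summable u\<close>])
      fix i
      have "real (i + r) powr (- q) = real (i + r) powr (- (q - 2)) * real (i + r) powr (- 2)"
        by (simp flip: powr_add)
      also have "\<dots> \<le> real r powr (- (q - 2)) * u i"
      proof (intro mult_mono)
        show "real (i + r) powr (- (q - 2)) \<le> real r powr (- (q - 2))"
          using that assms(3) by (intro powr_mono2') auto
        have "real (i + r) powr (- 2) = inverse (real (i + r) ^ 2)"
          using that by (simp add: powr_minus powr_numeral)
        also have "\<dots> \<le> u i" unfolding u_def using that by (intro le_imp_inverse_le power_mono) auto
        finally show "real (i + r) powr (- 2) \<le> u i" .
      qed auto
      finally have "C * real (i + r) powr (- q) \<le> C * (real r powr (- (q - 2)) * u i)"
        using assms(2) by (intro mult_left_mono) auto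
      then show "w (i + r) \<le> C * real r powr (- (q - 2)) * u i"
        using w[of "i + r"] that by (simp add: mult.assoc)
    qed
    then show ?thesis by (simp add: B_def mult_ac)
  qed
  define s where "s = q - 2 - \<epsilon>"
  \<comment> \<open>Any positive power of \<open>n\<close> as number of blocks makes the contraction
    term smaller than every negative power. So almost all of the length goes into the blocks, and
    \<open>a\<close> is what turns \<open>q - 2\<close> into
    \<open>q - 2 - \<epsilon>\<close>.\<close>
  define a where "a = \<epsilon> / (q - 2)"
  have a: "0 < a" "a < 1" "(1 - a) * (q - 2) = s" using assms by (auto simp: a_def s_def field_simps)
  obtain K where K: "K > 0" "\<And>n :: nat. n \<ge> 1 \<Longrightarrow> exp (- \<kappa> * real n powr a) \<le> K * real n powr (- s)"
    using stretched_exp_le_powr[OF \<open>\<kappa> > 0\<close> a(1), of s] by blast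
  \<comment> \<open>\<open>exp \<kappa>\<close> and \<open>2 powr (q - 2)\<close> compensate for
    rounding down the number of blocks and their length.\<close>
  define E where "E = exp \<kappa> * K + 2 * (B * 2 powr (q - 2))"
  define D where "D = max (C + 1) (?A * E)"
  have "variation (phi p) n \<le> ennreal (D * (1 / real n powr s))" if n: "n \<ge> 1" for n
  proof -
    define m where "m = nat \<lfloor>real n powr a\<rfloor>"
    define y where "y = real n powr (1 - a)"
    define r where "r = nat \<lfloor>y\<rfloor>"
    have mr: "m * r \<le> n" unfolding m_def r_def y_def by (rule floor_mult_le) simp
    have m: "real n powr a - 1 \<le> real m" unfolding m_def by linarith
    have y1: "y \<ge> 1" unfolding y_def using n a by (intro ge_one_powr_ge_zero) auto
    then have y: "y / 2 \<le> real r" unfolding r_def by (intro floor_half_le) simp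
    have "r \<ge> 1" using y1 by (simp add: r_def le_nat_iff)
    have "exp (- \<kappa> * real m) \<le> exp \<kappa> * exp (- \<kappa> * real n powr a)"
    proof -
      have "\<kappa> * (real n powr a - 1) \<le> \<kappa> * real m" using m \<open>\<kappa> > 0\<close> by (intro mult_left_mono) auto
      then show ?thesis unfolding mult_exp_exp by (simp add: algebra_simps)
    qed
    also have "\<dots> \<le> exp \<kappa> * (K * real n powr (- s))" using K(2)[OF n] by (intro mult_left_mono) auto
    finally have 1: "exp (- \<kappa> * real m) \<le> exp \<kappa> * (K * real n powr (- s))" .
    have "real r powr (- (q - 2)) \<le> (y / 2) powr (- (q - 2))"
      using y y1 assms(3) by (intro powr_mono2') auto
    also have "\<dots> = y powr (- (q - 2)) * 2 powr (q - 2)"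
      using y1 by (subst powr_divide) (simp_all add: powr_minus_divide[of 2 "q - 2"] del: minus_diff_eq)
    also have "y powr (- (q - 2)) = real n powr (- s)"
      unfolding y_def powr_powr using a(3) by (simp add: algebra_simps)
    finally have "B * real r powr (- (q - 2)) \<le> B * (real n powr (- s) * 2 powr (q - 2))"
      using \<open>B \<ge> 0\<close> by (rule mult_left_mono)
    then have "tail r \<le> B * (real n powr (- s) * 2 powr (q - 2))" using tail[OF \<open>r \<ge> 1\<close>] by linarith
    with 1 have "exp (- \<kappa> * real m) + 2 * tail r \<le> E * real n powr (- s)"
      unfolding E_def by (simp add: algebra_simps)
    then have "?A * (exp (- \<kappa> * real m) + 2 * tail r) \<le> ?A * (E * real n powr (- s))"
      by (intro mult_left_mono) auto
    also have "\<dots> = (?A * E) * real n powr (- s)" by simp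
    also have "\<dots> \<le> D * real n powr (- s)" unfolding D_def by (intro mult_right_mono) auto
    also have "\<dots> = D * (1 / real n powr s)" by (simp add: powr_minus_divide)
    finally show ?thesis
      using assms(1) mr unfolding \<kappa>_def by (intro variation_phi)
  qed
  moreover have "D > C" by (simp add: D_def)
  ultimately show ?thesis unfolding s_def by blast
qed

end

theorem theorem4p1:
  fixes p :: "'a :: {finite, discrete_topology} \<Rightarrow> 'b :: {finite, discrete_topology}"
    and \<psi> :: "(nat \<Rightarrow> 'a) \<Rightarrow> real"
    and \<mu> :: "(nat \<Rightarrow> 'a) measure"
    and \<mu>_approx :: "nat \<Rightarrow> (nat \<Rightarrow> 'a) measure"
  assumes "CARD('a) > CARD('b)" and "CARD('b) \<ge> 2"
    and "surj p"
    and "(\<Sum>s. of_nat (s ^ 2) * variation \<psi> s) < \<infinity>"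
    and "gibbs_measure \<mu> \<psi>"
    and "\<And>r. gibbs_measure (\<mu>_approx r) (approximant \<psi> r)"
  shows "\<exists>\<phi> :: (nat \<Rightarrow> 'b) \<Rightarrow> real.
    (\<exists>L :: nat \<Rightarrow> (nat \<Rightarrow> 'b) \<Rightarrow> real.
       (\<forall>r b. (\<lambda>n. ln (measure (pushforward p (\<mu>_approx r)) (cylinder (word b 0 n))
                       / measure (pushforward p (\<mu>_approx r)) (cylinder (word b 1 n))))
               \<longlonglongrightarrow> L r b) \<and>
       (\<forall>b. (\<lambda>r. L r b) \<longlonglongrightarrow> \<phi> b)) \<and>
    gibbs_measure (pushforward p \<mu>) \<phi> \<and>
    measure_support (pushforward p \<mu>) = UNIV \<and>
    pressure \<phi> = 0 \<and>
    (\<forall>C c \<gamma> :: real. C > 0 \<and> c > 0 \<and> 0 < \<gamma> \<and> \<gamma> < 1 \<and>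
       (\<forall>n. variation \<psi> n \<le> ennreal (C * exp (- c * real n powr \<gamma>))) \<longrightarrow>
       (\<exists>D d. D > C \<and> 0 < d \<and> d < c \<and>
          (\<forall>n. variation \<phi> n \<le> ennreal (D * exp (- d * real n powr (\<gamma> / (1 + \<gamma>))))))) \<and>
    (\<forall>C q :: real. C > 0 \<and> q > 3 \<and>
       (\<forall>n\<ge>1. variation \<psi> n \<le> ennreal (C * real n powr (- q))) \<longrightarrow>
       (\<forall>\<epsilon>. 0 < \<epsilon> \<and> \<epsilon> < q - 3 \<longrightarrow>
          (\<exists>D>C. \<forall>n\<ge>1. variation \<phi> n \<le> ennreal (D * (1 / real n powr (q - 2 - \<epsilon>))))))"
proof -
  \<comment> \<open>\<open>enn2real\<close> sends infinity to 0, so \<open>?w\<close> majorizes the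
    variations only because they are all finite.\<close>
  let ?w = "\<lambda>n. enn2real (variation \<psi> n)"
  have \<psi>: "summable_potential \<psi> ?w" by (rule summable_potential_variation(1)[OF assms(4,5)])
  interpret summable_potential \<psi> ?w by fact
  have approx: "summable_potential (approximant \<psi> r) ?w" for r by (rule summable_potential_approximant)
  have st: "stationary (pushforward p \<mu>)"
    using assms(5) by (intro stationary_pushforward) (simp add: stationary_def gibbs_measure_def)
  obtain C where C: "C \<ge> 1"
    "\<And>n b. inverse C \<le> measure (pushforward p \<mu>) (cylinder (word b 0 n)) / exp (birkhoff_sum (n + 1) (phi p) b)"
    "\<And>n b. measure (pushforward p \<mu>) (cylinder (word b 0 n)) / exp (birkhoff_sum (n + 1) (phi p) b) \<le> C"
    using gibbs_pushforward(1)[OF assms(5) \<psi> assms(3)] by auto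
  show ?thesis
  proof (intro exI[of _ "phi p"] conjI exI[of _ "\<lambda>r b. ln (summable_potential.qinf (approximant \<psi> r) (fiber p b))"] allI impI)
    show "(\<lambda>n. ln (measure (pushforward p (\<mu>_approx r)) (cylinder (word b 0 n))
                       / measure (pushforward p (\<mu>_approx r)) (cylinder (word b 1 n))))
               \<longlonglongrightarrow> ln (summable_potential.qinf (approximant \<psi> r) (fiber p b))" for r b
      by (rule pushforward_ratio_tendsto[OF assms(6) approx assms(3)])
    show "(\<lambda>r. ln (summable_potential.qinf (approximant \<psi> r) (fiber p b))) \<longlonglongrightarrow> phi p b" for b
      unfolding phi_def using qinf_pos[of "fiber p b"] fiber_ne[OF assms(3)]
      by (intro tendsto_ln qinf_tendsto[OF \<psi> approx] approximant_tendsto) (auto simp: less_imp_neq[symmetric])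
    show "gibbs_measure (pushforward p \<mu>) (phi p)"
      by (rule gibbs_pushforward(2)[OF assms(5) \<psi> assms(3)])
    show "measure_support (pushforward p \<mu>) = UNIV"
      by (rule measure_support_UNIV[OF st])
        (simp add: pushforward_eq_nu[OF assms(5) \<psi> assms(3)] nu_pos fib_ne[OF assms(3)])
    show "pressure (phi p) = 0"
      by (rule pressure_eq_0[OF st C])
  next
    fix C c \<gamma> :: real
    assume *: "C > 0 \<and> c > 0 \<and> 0 < \<gamma> \<and> \<gamma> < 1 \<and>
       (\<forall>n. variation \<psi> n \<le> ennreal (C * exp (- c * real n powr \<gamma>)))"
    then have "?w n \<le> C * exp (- c * real n powr \<gamma>)" for n by (intro enn2real_leI) auto
    with * show "\<exists>D d. D > C \<and> 0 < d \<and> d < c \<and>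
          (\<forall>n. variation (phi p) n \<le> ennreal (D * exp (- d * real n powr (\<gamma> / (1 + \<gamma>)))))"
      by (intro variation_phi_stretched assms(3)) auto
  next
    fix C q \<epsilon> :: real
    assume *: "C > 0 \<and> q > 3 \<and> (\<forall>n\<ge>1. variation \<psi> n \<le> ennreal (C * real n powr (- q)))"
      and \<epsilon>: "0 < \<epsilon> \<and> \<epsilon> < q - 3"
    then have "?w n \<le> C * real n powr (- q)" if "n \<ge> 1" for n using that by (intro enn2real_leI) auto
    with * \<epsilon> show "\<exists>D>C. \<forall>n\<ge>1. variation (phi p) n \<le> ennreal (D * (1 / real n powr (q - 2 - \<epsilon>)))"
      by (intro variation_phi_polynomial assms(3)) auto
  qed
qed

end
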